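(* There exist a $\sigma$-finite measure space $(\Omega,\mathcal{B},\mu)$ with $\mu(\Omega)=\infty$, a conservative, invertible, measure-preserving, ergodic transformation $T:\Omega\to\Omega$, a bounded measurable function (sampling function) $f:\Omega\to\mathbb{R}$, and $M>0$ such that the corresponding upper Lyapunov exponents satisfy $$\overline{L}^+(E)>\overline{L}^-(E)\quad\text{for all real }E>M,$$ and $$\overline{L}^+(E)<\overline{L}^-(E)\quad\text{for all real }E<-M.$$
   Context: A measurable transformation $T$ is: invertible if it is bijective and $T^{-1}$ is measurable; measure-preserving if $\mu(T^{-1}E)=\mu(E)$ for all $E\in\mathcal{B}$; ergodic if $T^{-1}E=E$ (with $E\in\mathcal{B}$) implies $\mu(E)=0$ or $\mu(\Omega\setminus E)=0$; conservative if there is no $W\in\mathcal{B}$ with $\mu(W)>0$ such that the sets $T^{-n}W$, $n\ge 0$, are pairwise disjoint. Transfer matrices: $A(E,\omega)=\begin{pmatrix}E-f(\omega)&-1\\1&0\end{pmatrix}$, and $A(E,n,\omega)=A(E,T^{n-1}\omega)\cdots A(E,\omega)$ for $n>0$, $A(E,0,\omega)=I$, $A(E,n,\omega)=A(E,T^{-|n|}\omega)^{-1}\cdots A(E,T^{-1}\omega)^{-1}$ for $n<0$. For each $E$, $\overline{L}^\pm(E)$ are the finite constants (which exist) such that $\limsup_{n\to\pm\infty}\frac1{|n|}\log\|A(E,n,\omega)\|=\overline{L}^\pm(E)$ for $\mu$-a.e. $\omega$. *)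

theory Defs
  imports "HOL-Analysis.Analysis"
begin

text \<open>
  Transformations of a measure space are total functions on the underlying type; only their
  values on \<open>space \<Omega>\<close> matter, so preimages and inverses are taken relative to \<open>space \<Omega>\<close>.
\<close>

definition inverse_map :: "'a measure \<Rightarrow> ('a \<Rightarrow> 'a) \<Rightarrow> 'a \<Rightarrow> 'a" where
  "inverse_map \<Omega> T = inv_into (space \<Omega>) T"

definition invertible_transformation :: "'a measure \<Rightarrow> ('a \<Rightarrow> 'a) \<Rightarrow> bool" where
  "invertible_transformation \<Omega> T \<longleftrightarrow>
     T \<in> measurable \<Omega> \<Omega> \<and> bij_betw T (space \<Omega>) (space \<Omega>) \<and>
     inverse_map \<Omega> T \<in> measurable \<Omega> \<Omega>"

definition measure_preserving_transformation :: "'a measure \<Rightarrow> ('a \<Rightarrow> 'a) \<Rightarrow> bool" where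
  "measure_preserving_transformation \<Omega> T \<longleftrightarrow>
     T \<in> measurable \<Omega> \<Omega> \<and>
     (\<forall>A\<in>sets \<Omega>. emeasure \<Omega> (T -` A \<inter> space \<Omega>) = emeasure \<Omega> A)"

definition ergodic_transformation :: "'a measure \<Rightarrow> ('a \<Rightarrow> 'a) \<Rightarrow> bool" where
  "ergodic_transformation \<Omega> T \<longleftrightarrow>
     T \<in> measurable \<Omega> \<Omega> \<and>
     (\<forall>A\<in>sets \<Omega>. T -` A \<inter> space \<Omega> = A \<longrightarrow>
        emeasure \<Omega> A = 0 \<or> emeasure \<Omega> (space \<Omega> - A) = 0)"

definition conservative_transformation :: "'a measure \<Rightarrow> ('a \<Rightarrow> 'a) \<Rightarrow> bool" where
  "conservative_transformation \<Omega> T \<longleftrightarrow>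
     T \<in> measurable \<Omega> \<Omega> \<and>
     \<not> (\<exists>W\<in>sets \<Omega>. emeasure \<Omega> W > 0 \<and>
          disjoint_family (\<lambda>n::nat. (T ^^ n) -` W \<inter> space \<Omega>))"

definition transfer_matrix :: "('a \<Rightarrow> real) \<Rightarrow> real \<Rightarrow> 'a \<Rightarrow> real ^ 2 ^ 2" where
  "transfer_matrix f E \<omega> = vector [vector [E - f \<omega>, - 1], vector [1, 0]]"

primrec forward_product ::
    "('a \<Rightarrow> 'a) \<Rightarrow> ('a \<Rightarrow> real) \<Rightarrow> real \<Rightarrow> nat \<Rightarrow> 'a \<Rightarrow> real ^ 2 ^ 2" where
  "forward_product T f E 0 \<omega> = mat 1"
| "forward_product T f E (Suc n) \<omega> =
     transfer_matrix f E ((T ^^ n) \<omega>) ** forward_product T f E n \<omega>"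

text \<open>Here \<open>S\<close> plays the role of the inverse of the transformation.\<close>

primrec backward_product ::
    "('a \<Rightarrow> 'a) \<Rightarrow> ('a \<Rightarrow> real) \<Rightarrow> real \<Rightarrow> nat \<Rightarrow> 'a \<Rightarrow> real ^ 2 ^ 2" where
  "backward_product S f E 0 \<omega> = mat 1"
| "backward_product S f E (Suc n) \<omega> =
     matrix_inv (transfer_matrix f E ((S ^^ Suc n) \<omega>)) ** backward_product S f E n \<omega>"

definition cocycle ::
    "'a measure \<Rightarrow> ('a \<Rightarrow> 'a) \<Rightarrow> ('a \<Rightarrow> real) \<Rightarrow> real \<Rightarrow> int \<Rightarrow> 'a \<Rightarrow> real ^ 2 ^ 2" where
  "cocycle \<Omega> T f E n \<omega> =
     (if n \<ge> 0 then forward_product T f E (nat n) \<omega>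
      else backward_product (inverse_map \<Omega> T) f E (nat \<bar>n\<bar>) \<omega>)"

text \<open>The matrix norm is the operator norm for the Euclidean norm on the plane.\<close>

definition growth_rate ::
    "'a measure \<Rightarrow> ('a \<Rightarrow> 'a) \<Rightarrow> ('a \<Rightarrow> real) \<Rightarrow> real \<Rightarrow> 'a \<Rightarrow> int \<Rightarrow> real" where
  "growth_rate \<Omega> T f E \<omega> n = ln (onorm ((*v) (cocycle \<Omega> T f E n \<omega>))) / \<bar>real_of_int n\<bar>"

text \<open>
  \<open>L\<close> is the upper Lyapunov exponent at \<open>E\<close> for \<open>n \<rightarrow> \<infinity>\<close>, resp.\ \<open>n \<rightarrow> -\<infinity>\<close>.
  Both are relations; \<open>L\<close> is a real number, hence finite, and it is unique as soon as
  \<open>\<Omega>\<close> is not a null space.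
\<close>

definition has_upper_lyapunov_plus ::
    "'a measure \<Rightarrow> ('a \<Rightarrow> 'a) \<Rightarrow> ('a \<Rightarrow> real) \<Rightarrow> real \<Rightarrow> real \<Rightarrow> bool" where
  "has_upper_lyapunov_plus \<Omega> T f E L \<longleftrightarrow>
     (AE \<omega> in \<Omega>. Limsup at_top (\<lambda>n. ereal (growth_rate \<Omega> T f E \<omega> n)) = ereal L)"

definition has_upper_lyapunov_minus ::
    "'a measure \<Rightarrow> ('a \<Rightarrow> 'a) \<Rightarrow> ('a \<Rightarrow> real) \<Rightarrow> real \<Rightarrow> real \<Rightarrow> bool" where
  "has_upper_lyapunov_minus \<Omega> T f E L \<longleftrightarrow>
     (AE \<omega> in \<Omega>. Limsup at_bot (\<lambda>n. ereal (growth_rate \<Omega> T f E \<omega> n)) = ereal L)"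

end

theory Submission
  imports Defs
begin

text \<open>
  Over the dyadic odometer on \<open>(0, 1)\<close>, erect a tower of height \<open>2 m\<^sub>k\<close> on the \<open>k\<close>-th interval of
  continuity, and let the potential be \<open>-2\<close> on the lower and \<open>2\<close> on the upper half of each tower.
  For growing \<open>m\<^sub>k\<close> the resulting skyscraper has infinite measure. The signs of \<open>-f\<close> along an orbit
  are the increments of a nonnegative walk that climbs from \<open>0\<close> to \<open>m\<^sub>k\<close> and back in each tower.
  Hence, forward in time, the partial sums are bounded below, while backward in time they are
  bounded above. As \<open>m\<^sub>k\<close> is much larger than the time needed to reach a tower over
  the \<open>k\<close>-th interval or a later one, the walk at the middle of that tower is almost equal to the
  time elapsed. So the lower halves have upper density \<open>1\<close> in forward time, but at most \<open>1/2\<close> in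
  backward time, and vice versa for the upper halves.

  For large \<open>\<bar>E\<bar>\<close>, the logarithm of the norm of the transfer matrices lies between the sums of
  \<open>ln (\<bar>E - f\<bar> - 1)\<close> and of \<open>ln (\<bar>E - f\<bar> + 1)\<close>. Hence the larger of the two exponents is at least
  \<open>ln (\<bar>E\<bar> + 1)\<close> and the smaller is at most \<open>(ln (\<bar>E\<bar> + 3) + ln (\<bar>E\<bar> - 1)) / 2\<close>; these do not
  overlap, since \<open>(\<bar>E\<bar> + 3) (\<bar>E\<bar> - 1) < (\<bar>E\<bar> + 1)\<^sup>2\<close>.
\<close>

section \<open>Norms of products of transfer matrices\<close>

lemma norm_le_mult_norm_iff:
  fixes v w :: "real ^ 2"
  assumes "c \<ge> 0"
  shows "norm w \<le> c * norm v \<longleftrightarrow> (w$1)\<^sup>2 + (w$2)\<^sup>2 \<le> c\<^sup>2 * ((v$1)\<^sup>2 + (v$2)\<^sup>2)"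
proof -
  have "norm w \<le> c * norm v \<longleftrightarrow> (norm w)\<^sup>2 \<le> (c * norm v)\<^sup>2"
    using abs_le_square_iff[of "norm w" "c * norm v"] assms by (simp add: abs_mult)
  moreover have "(norm u)\<^sup>2 = (u$1)\<^sup>2 + (u$2)\<^sup>2" for u :: "real ^ 2"
    by (simp add: norm_vec_def L2_set_def UNIV_2)
  ultimately show ?thesis by (simp add: power_mult_distrib)
qed

lemma transfer_matrix_apply:
  "(transfer_matrix f E \<omega> *v v) $ 1 = (E - f \<omega>) * v $ 1 - v $ 2"
  "(transfer_matrix f E \<omega> *v v) $ 2 = v $ 1"
  by (simp_all add: transfer_matrix_def matrix_vector_mult_def UNIV_2)

lemma matrix_inv_transfer_matrix:
  "matrix_inv (transfer_matrix f E \<omega>) = vector [vector [0, 1], vector [- 1, E - f \<omega>]]"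
    (is "_ = ?B")
proof -
  let ?A = "transfer_matrix f E \<omega>"
  have AB: "?A ** ?B = mat 1" "?B ** ?A = mat 1"
    by (simp_all add: transfer_matrix_def matrix_matrix_mult_def vec_eq_iff UNIV_2 forall_2 mat_def)
  \<comment> \<open>\<open>matrix_inv\<close> is a Hilbert choice, so the existence of a two-sided
    inverse comes first, and uniqueness then identifies the choice.\<close>
  then have "?A ** ?B = mat 1 \<and> ?B ** ?A = mat 1" ..
  then have "?A ** matrix_inv ?A = mat 1 \<and> matrix_inv ?A ** ?A = mat 1"
    unfolding matrix_inv_def by (rule someI)
  then have inv: "matrix_inv ?A ** ?A = mat 1" ..
  have "matrix_inv ?A = matrix_inv ?A ** (?A ** ?B)"
    by (simp only: AB matrix_mul_rid)
  also have "\<dots> = ?B"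
    by (simp only: matrix_mul_assoc inv matrix_mul_lid)
  finally show ?thesis .
qed

lemma matrix_inv_transfer_matrix_apply:
  "(matrix_inv (transfer_matrix f E \<omega>) *v v) $ 1 = v $ 2"
  "(matrix_inv (transfer_matrix f E \<omega>) *v v) $ 2 = (E - f \<omega>) * v $ 2 - v $ 1"
  by (simp_all add: matrix_inv_transfer_matrix matrix_vector_mult_def UNIV_2)

text \<open>The left side is the squared norm of the image under a transfer matrix or, with the
  coordinates swapped, under its inverse. The cross term is absorbed by \<open>2 * \<bar>a\<bar> *
  \<bar>b\<bar> \<le> a\<^sup>2 + b\<^sup>2\<close>.\<close>

lemma transfer_square_bound:
  fixes a b d :: real
  shows "(d * a - b)\<^sup>2 + a\<^sup>2 \<le> (\<bar>d\<bar> + 1)\<^sup>2 * (a\<^sup>2 + b\<^sup>2)"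
proof -
  have "- (2 * d * a * b) \<le> \<bar>d\<bar> * (2 * \<bar>a\<bar> * \<bar>b\<bar>)"
    using abs_ge_minus_self[of "2 * d * a * b"] by (simp add: abs_mult mult_ac)
  also have "\<dots> \<le> \<bar>d\<bar> * (a\<^sup>2 + b\<^sup>2)"
    using sum_squares_bound[of "\<bar>a\<bar>" "\<bar>b\<bar>"] by (intro mult_left_mono) auto
  finally have "- (2 * d * a * b) \<le> \<bar>d\<bar> * (a\<^sup>2 + b\<^sup>2)" .
  moreover have "0 \<le> \<bar>d\<bar> * (a\<^sup>2 + b\<^sup>2)" "0 \<le> d\<^sup>2 * b\<^sup>2" by auto
  moreover have "(d * a - b)\<^sup>2 = d\<^sup>2 * a\<^sup>2 - 2 * d * a * b + b\<^sup>2"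
    by (simp add: power2_diff power_mult_distrib)
  moreover have "(\<bar>d\<bar> + 1)\<^sup>2 * (a\<^sup>2 + b\<^sup>2)
      = d\<^sup>2 * a\<^sup>2 + d\<^sup>2 * b\<^sup>2 + 2 * (\<bar>d\<bar> * (a\<^sup>2 + b\<^sup>2)) + a\<^sup>2 + b\<^sup>2"
    by (simp add: power2_sum algebra_simps)
  ultimately show ?thesis by linarith
qed

lemma norm_transfer_matrix_le:
  "norm (transfer_matrix f E \<omega> *v v) \<le> (\<bar>E - f \<omega>\<bar> + 1) * norm v"
  using transfer_square_bound[of "E - f \<omega>" "v$1" "v$2"]
  by (subst norm_le_mult_norm_iff) (auto simp: transfer_matrix_apply)

lemma norm_matrix_inv_transfer_matrix_le:
  "norm (matrix_inv (transfer_matrix f E \<omega>) *v v) \<le> (\<bar>E - f \<omega>\<bar> + 1) * norm v"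
  using transfer_square_bound[of "E - f \<omega>" "v$2" "v$1"]
  by (subst norm_le_mult_norm_iff) (auto simp: matrix_inv_transfer_matrix_apply add.commute)

lemma transfer_matrix_cancel:
  "matrix_inv (transfer_matrix f E \<omega>) *v (transfer_matrix f E \<omega> *v v) = v"
  "transfer_matrix f E \<omega> *v (matrix_inv (transfer_matrix f E \<omega>) *v v) = v"
  by (simp_all add: vec_eq_iff forall_2 transfer_matrix_apply matrix_inv_transfer_matrix_apply)

text \<open>A common form for the forward and the backward products, so that the existence of
  exponents has to be proved only once.\<close>

primrec mprod :: "('a \<Rightarrow> 'a) \<Rightarrow> ('a \<Rightarrow> real ^ 'n ^ 'n) \<Rightarrow> nat \<Rightarrow> 'a \<Rightarrow> real ^ 'n ^ 'n" where
  "mprod S B 0 \<omega> = mat 1"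
| "mprod S B (Suc n) \<omega> = B ((S ^^ n) \<omega>) ** mprod S B n \<omega>"

lemma forward_product_eq_mprod:
  "forward_product T f E n \<omega> = mprod T (transfer_matrix f E) n \<omega>"
  by (induction n) auto

text \<open>The generator carries an extra \<open>S\<close> because the backward product starts at
  the first preimage, not at \<open>\<omega>\<close> itself.\<close>

lemma backward_product_eq_mprod:
  "backward_product S f E n \<omega> = mprod S (\<lambda>\<omega>. matrix_inv (transfer_matrix f E (S \<omega>))) n \<omega>"
  by (induction n) auto

text \<open>Splitting off the factor applied first relates the products at \<open>\<omega>\<close>
  and at \<open>S \<omega>\<close>; this yields the invariance of the exponents.\<close>

lemma mprod_Suc_right: "mprod S B (Suc n) \<omega> = mprod S B n (S \<omega>) ** B \<omega>"
proof (induction n)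
  case (Suc n)
  have "mprod S B (Suc (Suc n)) \<omega> = B ((S ^^ n) (S \<omega>)) ** (mprod S B n (S \<omega>) ** B \<omega>)"
    using Suc by (simp add: funpow_swap1)
  then show ?case by (simp add: matrix_mul_assoc)
qed simp

abbreviation mnorm :: "real ^ 'n ^ 'n \<Rightarrow> real" where
  "mnorm A \<equiv> onorm ((*v) A)"

lemma mnorm_mat_1: "mnorm (mat 1 :: real ^ 'n ^ 'n) = 1"
proof -
  have "(*v) (mat 1) = (\<lambda>v :: real ^ 'n. v)" by (simp add: fun_eq_iff)
  then show ?thesis using onorm_id[where 'a = "real ^ 'n"] by (simp only:)
qed

lemma mnorm_mult_le: "mnorm (A ** B) \<le> mnorm A * mnorm B"
  using onorm_compose[OF matrix_vector_mul_bounded_linear matrix_vector_mul_bounded_linear, of A B]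
  by (simp add: o_def matrix_vector_mul_assoc)

lemma norm_le_mnorm: "norm (A *v v) \<le> mnorm A * norm v"
  by (rule onorm[OF matrix_vector_mul_bounded_linear])

lemma mnorm_le:
  assumes "\<And>v. norm (A *v v) \<le> K * norm v" shows "mnorm A \<le> K"
  using assms by (rule onorm_le)

lemma mnorm_mprod_le:
  assumes "\<And>i v. norm (B ((S ^^ i) \<omega>) *v v) \<le> b i * norm v" "\<And>i. b i \<ge> 0"
  shows "mnorm (mprod S B n \<omega>) \<le> (\<Prod>i<n. b i)"
proof (induction n)
  case 0
  show ?case by (simp add: mnorm_mat_1 del: matrix_vector_mul_lid)
next
  case (Suc n)
  have "mnorm (mprod S B (Suc n) \<omega>) \<le> mnorm (B ((S ^^ n) \<omega>)) * mnorm (mprod S B n \<omega>)"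
    by (simp add: mnorm_mult_le)
  also have "\<dots> \<le> b n * (\<Prod>i<n. b i)"
    using Suc assms
    by (intro mult_mono) (auto intro: mnorm_le onorm_pos_le matrix_vector_mul_bounded_linear)
  finally show ?case by (simp add: mult.commute)
qed

text \<open>For \<open>\<bar>d\<bar> \<ge> 2\<close> the cone
  \<open>\<bar>b\<bar> \<le> \<bar>a\<bar>\<close> is mapped into itself, since the new first
  component dominates the old one.\<close>

lemma abs_diff_mult_ge:
  fixes a b d :: real
  assumes "\<bar>b\<bar> \<le> \<bar>a\<bar>" shows "\<bar>d * a - b\<bar> \<ge> (\<bar>d\<bar> - 1) * \<bar>a\<bar>"
proof -
  have "\<bar>d * a - b\<bar> \<ge> \<bar>d\<bar> * \<bar>a\<bar> - \<bar>b\<bar>" by (metis abs_mult abs_triangle_ineq2)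
  then show ?thesis using assms by (simp add: algebra_simps)
qed

text \<open>The dominant component of the orbit of a unit vector grows by at least \<open>\<bar>d\<bar> - 1\<close> in each step.\<close>

lemma mnorm_forward_ge:
  assumes "\<And>i. \<bar>E - f ((S ^^ i) \<omega>)\<bar> \<ge> 2"
  shows "(\<Prod>i<n. \<bar>E - f ((S ^^ i) \<omega>)\<bar> - 1) \<le> mnorm (mprod S (transfer_matrix f E) n \<omega>)"
proof -
  define v :: "nat \<Rightarrow> real ^ 2" where "v n = mprod S (transfer_matrix f E) n \<omega> *v axis 1 1" for n
  have [simp]: "v 0 = axis 1 1"
    "v (Suc n) = transfer_matrix f E ((S ^^ n) \<omega>) *v v n" for n
    by (simp_all add: v_def matrix_vector_mul_assoc)
  have "\<bar>v n $ 2\<bar> \<le> \<bar>v n $ 1\<bar> \<and> (\<Prod>i<n. \<bar>E - f ((S ^^ i) \<omega>)\<bar> - 1) \<le> \<bar>v n $ 1\<bar>"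
  proof (induction n)
    case (Suc n)
    let ?d = "E - f ((S ^^ n) \<omega>)"
    have "(\<bar>?d\<bar> - 1) * \<bar>v n $ 1\<bar> \<le> \<bar>v (Suc n) $ 1\<bar>"
      using Suc abs_diff_mult_ge[of "v n $ 2" "v n $ 1" ?d] by (simp add: transfer_matrix_apply)
    moreover have "1 * \<bar>v n $ 1\<bar> \<le> (\<bar>?d\<bar> - 1) * \<bar>v n $ 1\<bar>"
      using assms[of n] by (intro mult_right_mono) auto
    moreover have "(\<Prod>i<n. \<bar>E - f ((S ^^ i) \<omega>)\<bar> - 1) * (\<bar>?d\<bar> - 1) \<le> \<bar>v n $ 1\<bar> * (\<bar>?d\<bar> - 1)"
      using assms[of n] Suc by (intro mult_right_mono) auto
    ultimately show ?case by (simp add: transfer_matrix_apply mult.commute)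
  qed (simp add: axis_def)
  then have "(\<Prod>i<n. \<bar>E - f ((S ^^ i) \<omega>)\<bar> - 1) \<le> norm (v n)"
    using component_le_norm_cart[of "v n" 1] by (meson order_trans)
  then show ?thesis
    using norm_le_mnorm[of "mprod S (transfer_matrix f E) n \<omega>" "axis 1 1"]
    by (simp add: v_def)
qed

text \<open>The inverse matrices preserve the opposite cone, in which the second component
  dominates; therefore the orbit starts at the second unit vector.\<close>

lemma mnorm_backward_ge:
  assumes "\<And>i. \<bar>E - f ((S ^^ Suc i) \<omega>)\<bar> \<ge> 2"
  shows "(\<Prod>i<n. \<bar>E - f ((S ^^ Suc i) \<omega>)\<bar> - 1)
    \<le> mnorm (mprod S (\<lambda>\<omega>. matrix_inv (transfer_matrix f E (S \<omega>))) n \<omega>)"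
proof -
  define B where "B \<omega> = matrix_inv (transfer_matrix f E (S \<omega>))" for \<omega>
  define v :: "nat \<Rightarrow> real ^ 2" where "v n = mprod S B n \<omega> *v axis 2 1" for n
  have [simp]: "v 0 = axis 2 1" "v (Suc n) = B ((S ^^ n) \<omega>) *v v n" for n
    by (simp_all add: v_def matrix_vector_mul_assoc)
  have "\<bar>v n $ 1\<bar> \<le> \<bar>v n $ 2\<bar> \<and> (\<Prod>i<n. \<bar>E - f ((S ^^ Suc i) \<omega>)\<bar> - 1) \<le> \<bar>v n $ 2\<bar>"
  proof (induction n)
    case (Suc n)
    let ?d = "E - f ((S ^^ Suc n) \<omega>)"
    have "(\<bar>?d\<bar> - 1) * \<bar>v n $ 2\<bar> \<le> \<bar>v (Suc n) $ 2\<bar>"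
      using Suc abs_diff_mult_ge[of "v n $ 1" "v n $ 2" ?d]
      by (simp add: matrix_inv_transfer_matrix_apply B_def)
    moreover have "1 * \<bar>v n $ 2\<bar> \<le> (\<bar>?d\<bar> - 1) * \<bar>v n $ 2\<bar>"
      using assms[of n] by (intro mult_right_mono) auto
    moreover have "(\<Prod>i<n. \<bar>E - f ((S ^^ Suc i) \<omega>)\<bar> - 1) * (\<bar>?d\<bar> - 1) \<le> \<bar>v n $ 2\<bar> * (\<bar>?d\<bar> - 1)"
      using assms[of n] Suc by (intro mult_right_mono) auto
    ultimately show ?case by (simp add: matrix_inv_transfer_matrix_apply mult.commute B_def)
  qed (simp add: axis_def)
  then have "(\<Prod>i<n. \<bar>E - f ((S ^^ Suc i) \<omega>)\<bar> - 1) \<le> norm (v n)"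
    using component_le_norm_cart[of "v n" 2] by (meson order_trans)
  then show ?thesis
    using norm_le_mnorm[of "mprod S B n \<omega>" "axis 2 1"]
    by (simp add: v_def B_def[abs_def])
qed

section \<open>Growth rates as sequences over the natural numbers\<close>

lemma Limsup_growth_rate_at_top:
  "Limsup at_top (\<lambda>n. ereal (growth_rate \<Omega> T f E \<omega> n))
    = limsup (\<lambda>n. ereal (ln (mnorm (mprod T (transfer_matrix f E) n \<omega>)) / real n))"
proof -
  \<comment> \<open>The filter at infinity of the integers is carried by the naturals, so the limsup
    may be taken along the injection \<open>int\<close>.\<close>
  have "filtermap int sequentially = at_top"
  proof (rule filter_eqI[THEN sym])
    fix P :: "int \<Rightarrow> bool"
    show "eventually P at_top = eventually P (filtermap int sequentially)"
      unfolding eventually_filtermap eventually_at_top_linorder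
    proof safe
      fix N assume "\<forall>n\<ge>N. P n"
      then show "\<exists>N. \<forall>n\<ge>N. P (int n)" by (intro exI[of _ "nat N"]) auto
    next
      fix N assume *: "\<forall>n\<ge>N. P (int n)"
      have "P n" if "n \<ge> int N" for n
        using *[rule_format, of "nat n"] that by simp
      then show "\<exists>N. \<forall>n\<ge>N. P n" by blast
    qed
  qed
  then have "Limsup at_top (\<lambda>n. ereal (growth_rate \<Omega> T f E \<omega> n))
      = limsup (\<lambda>n. ereal (growth_rate \<Omega> T f E \<omega> (int n)))"
    using Limsup_filtermap_eq[OF inj_of_nat, of sequentially "\<lambda>n. ereal (growth_rate \<Omega> T f E \<omega> n)"]
    by simp
  then show ?thesis
    by (simp add: growth_rate_def cocycle_def forward_product_eq_mprod)
qed

lemma Limsup_growth_rate_at_bot: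
  "Limsup at_bot (\<lambda>n. ereal (growth_rate \<Omega> T f E \<omega> n))
    = limsup (\<lambda>n. ereal (ln (mnorm (mprod (inverse_map \<Omega> T)
        (\<lambda>\<omega>. matrix_inv (transfer_matrix f E (inverse_map \<Omega> T \<omega>))) n \<omega>)) / real n))"
proof -
  have "filtermap (\<lambda>n. - int n) sequentially = at_bot"
  proof (rule filter_eqI[THEN sym])
    fix P :: "int \<Rightarrow> bool"
    show "eventually P at_bot = eventually P (filtermap (\<lambda>n. - int n) sequentially)"
      unfolding eventually_filtermap eventually_at_top_linorder eventually_at_bot_linorder
    proof safe
      fix N assume "\<forall>n\<le>N. P n"
      then show "\<exists>N. \<forall>n\<ge>N. P (- int n)" by (intro exI[of _ "nat (- N)"]) auto
    next
      fix N assume *: "\<forall>n\<ge>N. P (- int n)"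
      have "P n" if "n \<le> - int N" for n
        using *[rule_format, of "nat (- n)"] that by simp
      then show "\<exists>N. \<forall>n\<le>N. P n" by blast
    qed
  qed
  moreover have "inj (\<lambda>n. - int n)" by (auto simp: inj_def)
  ultimately have "Limsup at_bot (\<lambda>n. ereal (growth_rate \<Omega> T f E \<omega> n))
      = limsup (\<lambda>n. ereal (growth_rate \<Omega> T f E \<omega> (- int n)))"
    using Limsup_filtermap_eq[of "\<lambda>n. - int n" sequentially "\<lambda>n. ereal (growth_rate \<Omega> T f E \<omega> n)"]
    by simp
  \<comment> \<open>At n = 0 \<open>cocycle\<close> takes its forward branch, but division by zero
    makes both sides 0 there.\<close>
  moreover have "growth_rate \<Omega> T f E \<omega> (- int n) = ln (mnorm (mprod (inverse_map \<Omega> T)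
        (\<lambda>\<omega>. matrix_inv (transfer_matrix f E (inverse_map \<Omega> T \<omega>))) n \<omega>)) / real n" for n
    by (auto simp: growth_rate_def cocycle_def backward_product_eq_mprod)
  ultimately show ?thesis by simp
qed

section \<open>Existence of upper Lyapunov exponents\<close>

lemma limsup_eq_if_diff_tendsto_0:
  fixes a b :: "nat \<Rightarrow> real"
  assumes "(\<lambda>n. a n - b n) \<longlonglongrightarrow> 0"
  shows "limsup (\<lambda>n. ereal (a n)) = limsup (\<lambda>n. ereal (b n))"
proof -
  have "(\<lambda>n. ereal (a n - b n)) \<longlonglongrightarrow> 0"
    using assms by (simp add: zero_ereal_def)
  then have "limsup (\<lambda>n. ereal (a n - b n) + ereal (b n)) = 0 + limsup (\<lambda>n. ereal (b n))"
    by (intro ereal_limsup_lim_add) auto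
  then show ?thesis by simp
qed

lemma AE_ex_in_space:
  assumes "AE \<omega> in M. P \<omega>" "emeasure M (space M) \<noteq> 0"
  shows "\<exists>\<omega>\<in>space M. P \<omega>"
proof -
  have "AE \<omega> in M. \<omega> \<in> space M \<and> P \<omega>" using assms(1) by auto
  then show ?thesis
    using assms(2) by (metis (lifting) eventually_happens' ae_filter_eq_bot_iff)
qed

text \<open>The sublevel sets of \<open>g\<close> are invariant, hence null or conull, so every
  number is an almost sure lower bound or an almost sure upper bound of \<open>g\<close>.\<close>

lemma ergodic_invariant_AE_const:
  fixes g :: "'a \<Rightarrow> ereal"
  assumes erg: "ergodic_transformation \<Omega> S" and [measurable]: "g \<in> borel_measurable \<Omega>"
    and inv: "\<And>\<omega>. \<omega> \<in> space \<Omega> \<Longrightarrow> g (S \<omega>) = g \<omega>"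
  shows "\<exists>c. AE \<omega> in \<Omega>. g \<omega> = c"
proof -
  \<comment> \<open>These are the essential infimum and the essential supremum of
    \<open>g\<close>.\<close>
  define c where "c = Sup {r. AE \<omega> in \<Omega>. r \<le> g \<omega>}"
  define d where "d = Inf {r. AE \<omega> in \<Omega>. g \<omega> \<le> r}"
  have S: "S \<omega> \<in> space \<Omega>" if "\<omega> \<in> space \<Omega>" for \<omega>
    using erg that by (auto simp: ergodic_transformation_def dest: measurable_space)
  have dichotomy: "(AE \<omega> in \<Omega>. r \<le> g \<omega>) \<or> (AE \<omega> in \<Omega>. g \<omega> \<le> r)" for r
  proof -
    define A where "A = {\<omega> \<in> space \<Omega>. g \<omega> < r}"
    have A: "A \<in> sets \<Omega>" unfolding A_def by measurable
    have "S -` A \<inter> space \<Omega> = A" using S inv by (auto simp: A_def)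
    then consider "emeasure \<Omega> A = 0" | "emeasure \<Omega> (space \<Omega> - A) = 0"
      using erg A by (auto simp: ergodic_transformation_def)
    then show ?thesis
    proof cases
      case 1
      have "AE \<omega> in \<Omega>. r \<le> g \<omega>"
        by (rule AE_I[OF _ 1 A]) (auto simp: A_def)
      then show ?thesis ..
    next
      case 2
      have "AE \<omega> in \<Omega>. g \<omega> \<le> r"
        by (rule AE_I[OF _ 2]) (use A in \<open>auto simp: A_def\<close>)
      then show ?thesis ..
    qed
  qed
  have "d \<le> c"
  proof (rule ccontr)
    assume "\<not> d \<le> c"
    then obtain r where r: "c < r" "r < d" using dense[of c d] by (auto simp: not_le)
    from dichotomy[of r] show False
      using r Sup_upper[of r "{r. AE \<omega> in \<Omega>. r \<le> g \<omega>}"] Inf_lower[of r "{r. AE \<omega> in \<Omega>. g \<omega> \<le> r}"]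
      by (auto simp: c_def d_def)
  qed
  have "AE \<omega> in \<Omega>. c \<le> g \<omega>"
  proof -
    have "{r. AE \<omega> in \<Omega>. r \<le> g \<omega>} \<noteq> {}" by (auto intro: exI[of _ "-\<infinity>"])
    \<comment> \<open>A countable family of bounds reaches the supremum, so that only countably many
      null sets have to be united.\<close>
    from Sup_countable_SUP[OF this] obtain u :: "nat \<Rightarrow> ereal"
      where u: "range u \<subseteq> {r. AE \<omega> in \<Omega>. r \<le> g \<omega>}" "c = Sup (range u)" by (auto simp: c_def)
    then have "AE \<omega> in \<Omega>. \<forall>n. u n \<le> g \<omega>" by (auto simp: AE_all_countable)
    then show ?thesis by eventually_elim (auto simp: u intro: SUP_least)
  qed
  moreover have "AE \<omega> in \<Omega>. g \<omega> \<le> d"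
  proof -
    have "{r. AE \<omega> in \<Omega>. g \<omega> \<le> r} \<noteq> {}" by (auto intro: exI[of _ "\<infinity>"])
    from Inf_countable_INF[OF this] obtain u :: "nat \<Rightarrow> ereal"
      where u: "range u \<subseteq> {r. AE \<omega> in \<Omega>. g \<omega> \<le> r}" "d = Inf (range u)" by (auto simp: d_def)
    then have "AE \<omega> in \<Omega>. \<forall>n. g \<omega> \<le> u n" by (auto simp: AE_all_countable)
    then show ?thesis by eventually_elim (auto simp: u intro: INF_greatest)
  qed
  ultimately have "AE \<omega> in \<Omega>. g \<omega> = c"
    by eventually_elim (use \<open>d \<le> c\<close> in auto)
  then show ?thesis ..
qed

text \<open>Finitely many values survive multiplication. Hence every function of the matrix
  products, in particular their norm, is measurable.\<close>

lemma simple_function_mprod: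
  assumes S: "S \<in> measurable \<Omega> \<Omega>" and B: "simple_function \<Omega> B"
  shows "simple_function \<Omega> (mprod S B n)"
proof (induction n)
  case 0
  show ?case by (simp cong: simple_function_cong)
next
  case (Suc n)
  have "(S ^^ n) \<in> measurable \<Omega> \<Omega>" using S by (rule measurable_compose_n)
  then have "simple_function \<Omega> (\<lambda>\<omega>. B ((S ^^ n) \<omega>))"
    using B by (rule simple_function_comp)
  from simple_function_compose2[OF this Suc, of "(**)"]
  show ?case by (simp cong: simple_function_cong)
qed

lemma abs_ln_diff_le:
  assumes "x > 0" "y > 0" "K > 0" "x \<le> K * y" "y \<le> K * x"
  shows "\<bar>ln x - ln y\<bar> \<le> ln (K :: real)"
proof -
  have "ln x \<le> ln (K * y)" "ln y \<le> ln (K * x)" using assms by (simp_all add: ln_mono)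
  then show ?thesis using assms by (simp add: ln_mult)
qed

text \<open>The logarithm of the norm changes by at most \<open>ln K\<close> when a factor is added
  at either end. So the limsup is invariant, hence almost surely constant by ergodicity, and it is
  bounded by \<open>ln K\<close> in absolute value.\<close>

lemma upper_lyapunov_exponent_exists:
  fixes B :: "'a \<Rightarrow> real ^ 'n ^ 'n"
  assumes erg: "ergodic_transformation \<Omega> S" and B: "simple_function \<Omega> B"
    and nonnull: "emeasure \<Omega> (space \<Omega>) \<noteq> 0" and K: "K \<ge> 1"
    and le: "\<And>\<omega> v. \<omega> \<in> space \<Omega> \<Longrightarrow> norm (B \<omega> *v v) \<le> K * norm v"
    and ge: "\<And>\<omega> v. \<omega> \<in> space \<Omega> \<Longrightarrow> norm v \<le> K * norm (B \<omega> *v v)"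
    and inv: "\<And>\<omega>. \<omega> \<in> space \<Omega> \<Longrightarrow> \<exists>C. B \<omega> ** C = mat 1 \<and> mnorm C \<le> K"
  shows "\<exists>L :: real. AE \<omega> in \<Omega>. limsup (\<lambda>n. ereal (ln (mnorm (mprod S B n \<omega>)) / real n)) = ereal L"
proof -
  define p where "p n \<omega> = mnorm (mprod S B n \<omega>)" for n \<omega>
  define g where "g \<omega> = limsup (\<lambda>n. ereal (ln (p n \<omega>) / real n))" for \<omega>
  have S: "S \<in> measurable \<Omega> \<Omega>" using erg by (simp add: ergodic_transformation_def)
  have Sn: "(S ^^ n) \<omega> \<in> space \<Omega>" if "\<omega> \<in> space \<Omega>" for n \<omega>
    using measurable_space[OF S] that by (induction n) auto
  have p0: "p 0 \<omega> = 1" for \<omega>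
    by (simp add: p_def mnorm_mat_1 del: matrix_vector_mul_lid)
  have p_Suc_le: "p (Suc n) \<omega> \<le> K * p n \<omega>" if "\<omega> \<in> space \<Omega>" for n \<omega>
  proof -
    have "p (Suc n) \<omega> \<le> mnorm (B ((S ^^ n) \<omega>)) * p n \<omega>"
      by (simp add: p_def mnorm_mult_le)
    also have "\<dots> \<le> K * p n \<omega>"
      using le Sn that unfolding p_def
      by (intro mult_right_mono mnorm_le onorm_pos_le matrix_vector_mul_bounded_linear) auto
    finally show ?thesis .
  qed
  have p_le_Suc: "p n \<omega> \<le> K * p (Suc n) \<omega>" if "\<omega> \<in> space \<Omega>" for n \<omega>
    unfolding p_def
  proof (rule mnorm_le)
    fix v
    have "norm (mprod S B n \<omega> *v v) \<le> K * norm (mprod S B (Suc n) \<omega> *v v)"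
      using ge[OF Sn[OF that, of n]] by (simp add: matrix_vector_mul_assoc[symmetric])
    also have "\<dots> \<le> K * (mnorm (mprod S B (Suc n) \<omega>) * norm v)"
      using K by (intro mult_left_mono norm_le_mnorm) auto
    finally show "norm (mprod S B n \<omega> *v v) \<le> K * mnorm (mprod S B (Suc n) \<omega>) * norm v"
      by (simp add: mult.assoc)
  qed
  have p_pos: "p n \<omega> > 0" if "\<omega> \<in> space \<Omega>" for n \<omega>
  proof (induction n)
    case (Suc n)
    then have "0 < K * p (Suc n) \<omega>" using p_le_Suc[OF that, of n] by linarith
    then show ?case using K by (simp add: zero_less_mult_iff)
  qed (simp add: p0)
  have ln_Suc: "\<bar>ln (p (Suc n) \<omega>) - ln (p n \<omega>)\<bar> \<le> ln K" if "\<omega> \<in> space \<Omega>" for n \<omega>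
    using that K p_Suc_le p_le_Suc p_pos by (intro abs_ln_diff_le) auto
  have ln_S: "\<bar>ln (p (Suc n) \<omega>) - ln (p n (S \<omega>))\<bar> \<le> ln K" if \<omega>: "\<omega> \<in> space \<Omega>" for n \<omega>
  proof (rule abs_ln_diff_le)
    have eq: "mprod S B (Suc n) \<omega> = mprod S B n (S \<omega>) ** B \<omega>" by (rule mprod_Suc_right)
    have p_nonneg: "0 \<le> p n (S \<omega>)" by (simp add: p_def onorm_pos_le matrix_vector_mul_bounded_linear)
    have "p (Suc n) \<omega> \<le> p n (S \<omega>) * mnorm (B \<omega>)"
      unfolding p_def eq by (rule mnorm_mult_le)
    also have "\<dots> \<le> p n (S \<omega>) * K"
      using p_nonneg le[OF \<omega>] by (intro mult_left_mono mnorm_le) auto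
    finally show "p (Suc n) \<omega> \<le> K * p n (S \<omega>)" by (simp add: mult.commute)
    \<comment> \<open>Multiplying by the right inverse of the first factor recovers the product at
      \<open>S \<omega>\<close> from that at \<open>\<omega>\<close>.\<close>
    obtain C where C: "B \<omega> ** C = mat 1" "mnorm C \<le> K" using inv[OF \<omega>] by auto
    have "p n (S \<omega>) = mnorm (mprod S B (Suc n) \<omega> ** C)"
      unfolding p_def eq matrix_mul_assoc[symmetric] C by simp
    also have "\<dots> \<le> p (Suc n) \<omega> * mnorm C" unfolding p_def by (rule mnorm_mult_le)
    also have "\<dots> \<le> p (Suc n) \<omega> * K"
      using C p_pos[OF \<omega>, of "Suc n"] by (intro mult_left_mono) auto
    finally show "p n (S \<omega>) \<le> K * p (Suc n) \<omega>" by (simp add: mult.commute)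
    show "p (Suc n) \<omega> > 0" "p n (S \<omega>) > 0" "K > 0"
      using p_pos \<omega> measurable_space[OF S] K by auto
  qed
  have "g \<in> borel_measurable \<Omega>"
    unfolding g_def p_def
    using simple_function_mprod[OF S B]
    by (intro borel_measurable_limsup borel_measurable_simple_function
        simple_function_compose1[where g = "\<lambda>A. ereal (ln (mnorm A) / real n)" for n])
  moreover have "g (S \<omega>) = g \<omega>" if \<omega>: "\<omega> \<in> space \<Omega>" for \<omega>
    unfolding g_def
  proof (rule limsup_eq_if_diff_tendsto_0)
    show "(\<lambda>n. ln (p n (S \<omega>)) / real n - ln (p n \<omega>) / real n) \<longlonglongrightarrow> 0"
    proof (rule Lim_null_comparison)
      show "\<forall>\<^sub>F n in sequentially.
          norm (ln (p n (S \<omega>)) / real n - ln (p n \<omega>) / real n) \<le> 2 * ln K / real n"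
      proof (intro always_eventually allI)
        fix n
        have "\<bar>ln (p n (S \<omega>)) - ln (p n \<omega>)\<bar> \<le> 2 * ln K"
          using ln_Suc[OF \<omega>, of n] ln_S[OF \<omega>, of n] by linarith
        then show "norm (ln (p n (S \<omega>)) / real n - ln (p n \<omega>) / real n) \<le> 2 * ln K / real n"
          by (simp add: diff_divide_distrib[symmetric] divide_right_mono)
      qed
      show "(\<lambda>n. 2 * ln K / real n) \<longlonglongrightarrow> 0"
        by (rule lim_const_over_n)
    qed
  qed
  ultimately obtain c where c: "AE \<omega> in \<Omega>. g \<omega> = c"
    using ergodic_invariant_AE_const[OF erg, of g] by blast
  \<comment> \<open>The space is not null, so the constant is attained at some point; its finiteness
    is read off there.\<close>
  have "\<exists>\<omega>\<in>space \<Omega>. g \<omega> = c"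
    using AE_ex_in_space[OF c nonnull] .
  then obtain \<omega> where \<omega>: "\<omega> \<in> space \<Omega>" "g \<omega> = c" by auto
  have ln_p: "\<bar>ln (p n \<omega>)\<bar> \<le> real n * ln K" for n
  proof (induction n)
    case (Suc n)
    then show ?case using ln_Suc[OF \<omega>(1), of n] by (simp add: algebra_simps)
  qed (simp add: p0)
  have bd: "\<bar>ln (p n \<omega>) / real n\<bar> \<le> ln K" for n
    using ln_p[of n] K by (cases "n = 0") (auto simp: field_simps)
  have bd': "ln (p n \<omega>) / real n \<le> ln K" "- ln K \<le> ln (p n \<omega>) / real n" for n
    using bd[of n] by linarith+
  have "g \<omega> \<le> ereal (ln K)"
    unfolding g_def using bd' by (intro Limsup_bounded always_eventually allI) simp
  moreover have "ereal (- ln K) \<le> g \<omega>"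
    unfolding g_def using bd'
    by (intro order_trans[OF _ Liminf_le_Limsup] Liminf_bounded always_eventually allI)
      auto
  ultimately obtain L where "c = ereal L" using \<omega> by (cases c) auto
  with c show ?thesis by (auto simp: g_def p_def)
qed

section \<open>The skyscraper over the dyadic odometer\<close>

lemma irrational_add: "x \<notin> \<rat> \<Longrightarrow> r \<in> \<rat> \<Longrightarrow> x + r \<notin> \<rat>" for x r :: real
  by (metis Rats_diff add_diff_cancel_right')

text \<open>
  \<open>height N\<close> will bound the time in which an orbit visits all dyadic intervals of length \<open>1 / 2 ^ N\<close>
  of the base. The towers over the \<open>k\<close>-th interval have height \<open>2 * mid k\<close>, where \<open>mid k\<close> is
  chosen such that it outgrows \<open>height k\<close>.
\<close>

primrec height :: "nat \<Rightarrow> nat" where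
  "height 0 = 0"
| "height (Suc k) = 2 * height k + 2 * (Suc k * Suc (height k))"

definition mid :: "nat \<Rightarrow> nat" where "mid k = Suc k * Suc (height k)"

text \<open>To meet all intervals of half the length, an orbit runs through the longer ones, climbs
  the tower over the \<open>k\<close>-th interval, which takes \<open>2 * mid k\<close> steps, and
  runs through the longer ones once more. The recursion of \<open>height\<close> spells out
  \<open>mid k\<close>, because \<open>mid\<close> is defined from it.\<close>

lemma height_Suc: "height (Suc k) = 2 * height k + 2 * mid k"
  by (simp add: mid_def)

declare height.simps(2) [simp del]

lemma mid_pos [simp]: "mid k > 0"
  by (simp add: mid_def)

lemma height_mono: "i \<le> j \<Longrightarrow> height i \<le> height j"
  by (rule lift_Suc_mono_le[of height]) (simp_all add: height_Suc)

lemma mid_mono: "i \<le> j \<Longrightarrow> mid i \<le> mid j"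
  unfolding mid_def by (intro mult_mono) (auto simp: height_mono)

text \<open>Needed for infinite measure: the \<open>k\<close>-th interval has length
  \<open>1 / 2 ^ Suc k\<close>, and the tower over it has at least \<open>2 ^ Suc k\<close>
  levels.\<close>

lemma power2_le_mid: "2 ^ k \<le> mid k"
proof -
  have "2 ^ k \<le> Suc (height k)"
  proof (induction k)
    case (Suc k)
    then show ?case using mid_pos[of k] by (simp add: height_Suc del: mid_pos)
  qed simp
  also have "\<dots> \<le> mid k" by (simp add: mid_def)
  finally show ?thesis .
qed

section \<open>The dyadic odometer\<close>

definition cell :: "real \<Rightarrow> nat" where "cell x = (LEAST k. x < 1 - 1 / 2 ^ Suc k)"

lemma cell_eqI:
  assumes "1 - 1 / 2 ^ k \<le> x" "x < 1 - 1 / 2 ^ Suc k"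
  shows "cell x = k"
  unfolding cell_def
proof (rule Least_equality)
  fix i assume i: "x < 1 - 1 / 2 ^ Suc i"
  show "k \<le> i"
  proof (rule ccontr)
    assume "\<not> k \<le> i"
    then have "1 / 2 ^ k \<le> (1 / 2 ^ Suc i :: real)"
      by (intro divide_left_mono power_increasing) auto
    with i assms show False by linarith
  qed
qed fact

lemma cell_bounds:
  assumes "0 \<le> x" "x < 1"
  shows "1 - 1 / 2 ^ cell x \<le> x" "x < 1 - 1 / 2 ^ Suc (cell x)"
proof -
  obtain n where "inverse (2 ^ n) < 1 - x"
    using reals_power_lt_ex[of "1 - x" 2] assms by (auto simp: power_one_over inverse_eq_divide)
  moreover have "1 / 2 ^ Suc n \<le> (1 / 2 ^ n :: real)"
    by (intro divide_left_mono power_increasing) auto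
  ultimately have ex: "\<exists>n. x < 1 - 1 / 2 ^ Suc n"
    by (intro exI[of _ n]) (simp add: inverse_eq_divide)
  from LeastI_ex[OF this] show "x < 1 - 1 / 2 ^ Suc (cell x)"
    unfolding cell_def .
  show "1 - 1 / 2 ^ cell x \<le> x"
  proof (cases "cell x")
    case (Suc k)
    then have "\<not> x < 1 - 1 / 2 ^ Suc k"
      by (metis cell_def lessI not_less_Least)
    with Suc show ?thesis by simp
  qed (use assms in simp)
qed

lemma cell_ge:
  assumes "1 - 1 / 2 ^ k \<le> x" "x < 1" shows "k \<le> cell x"
proof (rule ccontr)
  assume "\<not> k \<le> cell x"
  then have "1 / 2 ^ k \<le> (1 / 2 ^ Suc (cell x) :: real)"
    by (intro divide_left_mono power_increasing) auto
  moreover have "0 \<le> 1 - 1 / (2 ^ k :: real)" by simp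
  ultimately show False using cell_bounds[of x] assms by linarith
qed

text \<open>Leaving out the null set of rationals keeps every point away from the end points of the
  intervals, and irrationality is preserved by all translations involved, as these are
  rational.\<close>

definition odometer_space :: "real set" where
  "odometer_space = {x. 0 < x \<and> x < 1 \<and> x \<notin> \<rat>}"

text \<open>The von Neumann-Kakutani map, which adds 1 to the first binary digit with carry to the
  right: \<open>cell x\<close> counts the leading digits 1 of \<open>x\<close>, and the
  \<open>k\<close>-th interval, from \<open>1 - 1 / 2 ^ k\<close> to
  \<open>1 - 1 / 2 ^ Suc k\<close>, is translated onto that from \<open>1 / 2 ^ Suc k\<close> to
  \<open>1 / 2 ^ k\<close>.\<close>

definition odometer :: "real \<Rightarrow> real" where
  "odometer x = x - 1 + 3 / 2 ^ Suc (cell x)"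

text \<open>Passing from \<open>y\<close> to \<open>1 - y\<close> exchanges the digits 0 and 1, so
  \<open>cell (1 - y)\<close> counts the leading digits 0, which are the carry to be undone.\<close>

definition odometer_inv :: "real \<Rightarrow> real" where
  "odometer_inv y = y + 1 - 3 / 2 ^ Suc (cell (1 - y))"

lemma cell_one_minus_bounds:
  assumes "y \<in> odometer_space"
  shows "1 / 2 ^ Suc (cell (1 - y)) < y" "y < 1 / 2 ^ cell (1 - y)"
proof -
  have "y \<notin> \<rat>" and b: "0 \<le> 1 - y" "1 - y < 1" using assms by (auto simp: odometer_space_def)
  have "1 / 2 ^ cell (1 - y) \<in> (\<rat> :: real set)" by simp
  with \<open>y \<notin> \<rat>\<close> have "y \<noteq> 1 / 2 ^ cell (1 - y)" by metis
  then show "1 / 2 ^ Suc (cell (1 - y)) < y" "y < 1 / 2 ^ cell (1 - y)"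
    using cell_bounds[OF b] by linarith+
qed

lemma odometer:
  assumes "x \<in> odometer_space"
  shows "odometer x \<in> odometer_space" "cell (1 - odometer x) = cell x"
    "odometer_inv (odometer x) = x"
proof -
  let ?k = "cell x"
  have x: "0 < x" "x < 1" "x \<notin> \<rat>" using assms by (auto simp: odometer_space_def)
  then have b: "1 - 1 / 2 ^ ?k \<le> x" "x < 1 - 1 / 2 ^ Suc ?k" using cell_bounds[of x] by auto
  have pow: "1 / 2 ^ ?k = 2 * (1 / 2 ^ Suc ?k :: real)" "0 < (1 / 2 ^ Suc ?k :: real)" by auto
  have eq: "odometer x = x - 1 + 3 * (1 / 2 ^ Suc ?k)" by (simp add: odometer_def)
  have irr: "odometer x \<notin> \<rat>"
    using irrational_add[OF x(3), of "3 / 2 ^ Suc ?k - 1"] by (simp add: odometer_def algebra_simps)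
  have lt: "odometer x < 2 * (1 / 2 ^ Suc ?k)" and ge: "1 / 2 ^ Suc ?k \<le> odometer x"
    using b pow eq by linarith+
  moreover have "2 * (1 / 2 ^ Suc ?k) \<le> (1 :: real)"
    using one_le_power[of "2 :: real" ?k] by simp
  ultimately have "0 < odometer x" "odometer x < 1" using lt ge pow by linarith+
  with irr show "odometer x \<in> odometer_space" by (simp add: odometer_space_def)
  have "odometer x \<noteq> 1 / 2 ^ Suc ?k" using irr by auto
  with lt ge pow have "1 - 1 / 2 ^ ?k \<le> 1 - odometer x" "1 - odometer x < 1 - 1 / 2 ^ Suc ?k"
    by linarith+
  then show cell: "cell (1 - odometer x) = ?k" by (rule cell_eqI)
  then show "odometer_inv (odometer x) = x" by (simp add: odometer_inv_def odometer_def)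
qed

lemma odometer_inv:
  assumes "y \<in> odometer_space"
  shows "odometer_inv y \<in> odometer_space" "cell (odometer_inv y) = cell (1 - y)"
    "odometer (odometer_inv y) = y"
proof -
  let ?k = "cell (1 - y)"
  have y: "0 < y" "y < 1" "y \<notin> \<rat>" using assms by (auto simp: odometer_space_def)
  have b: "1 / 2 ^ Suc ?k < y" "y < 1 / 2 ^ ?k" by (rule cell_one_minus_bounds[OF assms])+
  have pow: "1 / 2 ^ ?k = 2 * (1 / 2 ^ Suc ?k :: real)" "0 < (1 / 2 ^ Suc ?k :: real)" by auto
  have eq: "odometer_inv y = y + 1 - 3 * (1 / 2 ^ Suc ?k)" by (simp add: odometer_inv_def)
  have irr: "odometer_inv y \<notin> \<rat>"
    using irrational_add[OF y(3), of "1 - 3 / 2 ^ Suc ?k"] by (simp add: odometer_inv_def algebra_simps)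
  have ge: "1 - 1 / 2 ^ ?k \<le> odometer_inv y" and lt: "odometer_inv y < 1 - 1 / 2 ^ Suc ?k"
    using b pow eq by linarith+
  from cell_eqI[OF this] show cell: "cell (odometer_inv y) = ?k" .
  have "0 \<le> 1 - 1 / (2 ^ ?k :: real)" by simp
  then have "0 \<le> odometer_inv y" using ge by linarith
  moreover have "odometer_inv y \<noteq> 0" using irr by auto
  moreover have "odometer_inv y < 1" using lt pow by linarith
  ultimately show "odometer_inv y \<in> odometer_space" using irr by (auto simp: odometer_space_def)
  show "odometer (odometer_inv y) = y" using cell by (simp add: odometer_inv_def odometer_def)
qed

text \<open>The point \<open>x + j\<close> with \<open>x\<close> in the odometer space represents the level \<open>j\<close> of the tower over \<open>x\<close>.\<close>

definition level :: "real \<Rightarrow> nat" where "level y = nat \<lfloor>y\<rfloor>"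

definition half :: "real \<Rightarrow> nat" where "half y = mid (cell (frac y))"

text \<open>Stacking the levels over \<open>x\<close> as \<open>x\<close>, \<open>x + 1\<close>,
  \<open>x + 2\<close> and so on keeps the space inside the real line, so that Lebesgue measure can
  serve as the measure of the skyscraper.\<close>

definition skyscraper :: "real set" where
  "skyscraper = {y. 0 < y \<and> y \<notin> \<rat> \<and> level y < 2 * half y}"

definition tower_map :: "real \<Rightarrow> real" where
  "tower_map y = (if Suc (level y) < 2 * half y then y + 1 else odometer (frac y))"

text \<open>A point of the skyscraper below 1 lies in the base and comes from the top level of the
  tower over \<open>odometer_inv y\<close>, whose interval has the index
  \<open>cell (1 - y)\<close>.\<close>

definition tower_map_inv :: "real \<Rightarrow> real" where
  "tower_map_inv y =
     (if 1 \<le> y then y - 1 else odometer_inv y + real (2 * mid (cell (1 - y)) - 1))"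

lemma level_add [simp]:
  assumes "x \<in> odometer_space" shows "level (x + real j) = j"
proof -
  have "\<lfloor>x\<rfloor> = 0" using assms by (simp add: floor_eq_iff odometer_space_def)
  then show ?thesis by (simp add: level_def)
qed

lemma frac_add [simp]: "x \<in> odometer_space \<Longrightarrow> frac (x + real j) = x"
  by (auto simp: odometer_space_def frac_unique_iff)

lemma level_odometer_space [simp]: "x \<in> odometer_space \<Longrightarrow> level x = 0"
  using level_add[of x 0] by simp

lemma half_add [simp]: "x \<in> odometer_space \<Longrightarrow> half (x + real j) = mid (cell x)"
  by (simp add: half_def)

lemma add_mem_skyscraper [simp]:
  assumes "x \<in> odometer_space" "j < 2 * mid (cell x)"
  shows "x + real j \<in> skyscraper"
  using assms irrational_add[of x "real j"]
  by (auto simp: skyscraper_def) (auto simp: odometer_space_def)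

lemma odometer_space_subset: "x \<in> odometer_space \<Longrightarrow> x \<in> skyscraper"
  using add_mem_skyscraper[of x 0] by simp

lemma skyscraperE:
  assumes "y \<in> skyscraper"
  obtains x j where "y = x + real j" "x \<in> odometer_space" "j < 2 * mid (cell x)"
proof
  have y: "y > 0" "y \<notin> \<rat>" "level y < 2 * half y" using assms by (auto simp: skyscraper_def)
  show eq: "y = frac y + real (level y)" using y by (simp add: frac_def level_def)
  have "frac y \<notin> \<rat>" using y(2) eq by (metis Rats_add Rats_of_nat)
  moreover from this have "frac y \<noteq> 0" by (metis Rats_0)
  ultimately show "frac y \<in> odometer_space"
    using frac_ge_0[of y] frac_lt_1[of y] unfolding odometer_space_def by auto
  show "level y < 2 * mid (cell (frac y))" using y by (simp add: half_def)
qed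

lemma tower_map_add:
  assumes "x \<in> odometer_space"
  shows "tower_map (x + real j) = (if Suc j < 2 * mid (cell x) then x + real (Suc j) else odometer x)"
  using assms by (simp add: tower_map_def add_ac)

lemma tower_map_inv_add_Suc:
  assumes "x \<in> odometer_space"
  shows "tower_map_inv (x + real (Suc j)) = x + real j"
  using assms by (simp add: tower_map_inv_def odometer_space_def)

lemma tower_map_inv_base:
  assumes "x \<in> odometer_space"
  shows "tower_map_inv x = odometer_inv x + real (2 * mid (cell (1 - x)) - 1)"
  using assms by (simp add: tower_map_inv_def odometer_space_def)

lemma tower_map:
  assumes "y \<in> skyscraper"
  shows "tower_map y \<in> skyscraper" "tower_map_inv (tower_map y) = y"
proof -
  from assms obtain x j where y: "y = x + real j" "x \<in> odometer_space" "j < 2 * mid (cell x)"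
    by (rule skyscraperE)
  show "tower_map y \<in> skyscraper"
    using y odometer(1)[OF y(2)] by (auto simp: tower_map_add odometer_space_subset simp del: of_nat_Suc)
  show "tower_map_inv (tower_map y) = y"
  proof (cases "Suc j < 2 * mid (cell x)")
    case True
    with y show ?thesis by (simp add: tower_map_add tower_map_inv_add_Suc del: of_nat_Suc)
  next
    case False
    with y have "2 * mid (cell x) - 1 = j" by simp
    with False y odometer[OF y(2)] show ?thesis
      by (simp add: tower_map_add tower_map_inv_base)
  qed
qed

lemma tower_map_inv:
  assumes "y \<in> skyscraper"
  shows "tower_map_inv y \<in> skyscraper" "tower_map (tower_map_inv y) = y"
proof -
  from assms obtain x j where y: "y = x + real j" "x \<in> odometer_space" "j < 2 * mid (cell x)"
    by (rule skyscraperE)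
  have "tower_map_inv y \<in> skyscraper \<and> tower_map (tower_map_inv y) = y"
  proof (cases j)
    case 0
    with y odometer_inv[OF y(2)] mid_pos[of "cell (1 - x)"] show ?thesis
      by (auto simp: tower_map_add tower_map_inv_base simp del: mid_pos of_nat_diff
          intro!: add_mem_skyscraper)
  next
    case (Suc i)
    with y show ?thesis
      by (auto simp: tower_map_add tower_map_inv_add_Suc simp del: of_nat_Suc)
  qed
  then show "tower_map_inv y \<in> skyscraper" "tower_map (tower_map_inv y) = y" by auto
qed

section \<open>Iterates of the tower map and visits to dyadic intervals\<close>

lemma funpow_tower_map_mem: "y \<in> skyscraper \<Longrightarrow> (tower_map ^^ n) y \<in> skyscraper"
  by (induction n) (auto simp: tower_map)

lemma funpow_tower_map_inv_mem: "y \<in> skyscraper \<Longrightarrow> (tower_map_inv ^^ n) y \<in> skyscraper"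
  by (induction n) (auto simp: tower_map_inv)

lemma funpow_tower_map_inv_tower_map:
  "y \<in> skyscraper \<Longrightarrow> (tower_map_inv ^^ n) ((tower_map ^^ n) y) = y"
proof (induction n)
  case (Suc n)
  then show ?case
    by (subst funpow_Suc_right) (simp add: tower_map funpow_tower_map_mem)
qed simp

lemma funpow_tower_map_base:
  assumes "x \<in> odometer_space" "j < 2 * mid (cell x)"
  shows "(tower_map ^^ j) x = x + real j"
  using assms(2) by (induction j) (use assms(1) in \<open>auto simp: tower_map_add simp del: of_nat_Suc\<close>)

lemma funpow_tower_map_return:
  assumes "x \<in> odometer_space"
  shows "(tower_map ^^ (2 * mid (cell x))) x = odometer x"
proof -
  have "2 * mid (cell x) = Suc (2 * mid (cell x) - 1)" using mid_pos[of "cell x"] by linarith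
  then have "(tower_map ^^ (2 * mid (cell x))) x = tower_map ((tower_map ^^ (2 * mid (cell x) - 1)) x)"
    by (metis funpow.simps(2) comp_apply)
  also have "\<dots> = odometer x"
    using assms mid_pos[of "cell x"] by (subst funpow_tower_map_base) (auto simp: tower_map_add simp del: of_nat_diff)
  finally show ?thesis .
qed

lemma funpow_tower_map_inv_level:
  assumes "x \<in> odometer_space"
  shows "i \<le> j \<Longrightarrow> (tower_map_inv ^^ i) (x + real j) = x + real (j - i)"
proof (induction i)
  case (Suc i)
  then have "j - i = Suc (j - Suc i)" by simp
  with Suc assms show ?case by (simp add: tower_map_inv_add_Suc del: of_nat_Suc of_nat_diff)
qed simp

lemma tower_map_inv_returns:
  assumes "y \<in> skyscraper" shows "\<exists>t. (tower_map_inv ^^ t) y \<in> odometer_space"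
proof -
  from assms obtain x j where y: "y = x + real j" "x \<in> odometer_space" by (rule skyscraperE)
  have "(tower_map_inv ^^ j) y = x" using funpow_tower_map_inv_level[OF y(2), of j j] y by simp
  with y show ?thesis by (intro exI[of _ j]) simp
qed

lemma tower_map_returns:
  assumes "y \<in> skyscraper" shows "\<exists>t. (tower_map ^^ t) y \<in> odometer_space"
proof -
  from assms obtain x j where y: "y = x + real j" "x \<in> odometer_space" "j < 2 * mid (cell x)"
    by (rule skyscraperE)
  have "(tower_map ^^ (2 * mid (cell x) - j)) y
      = (tower_map ^^ (2 * mid (cell x) - j)) ((tower_map ^^ j) x)"
    using y by (simp add: funpow_tower_map_base)
  also have "\<dots> = (tower_map ^^ (2 * mid (cell x) - j + j)) x"
    by (simp only: funpow_add comp_apply)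
  also have "\<dots> = odometer x"
    using y by (simp add: funpow_tower_map_return)
  finally show ?thesis using odometer(1)[OF y(2)] by metis
qed

text \<open>The odometer counts through the first \<open>N\<close> binary digits until all of them
  are 1. In the induction, the points with even \<open>i\<close> belong to the orbit piece of
  \<open>z\<close> at stage \<open>N\<close>, and those with odd \<open>i\<close> to that of
  \<open>z + 1 / 2 ^ Suc N\<close>; a climb through the tower over the \<open>N\<close>-th interval
  connects the two pieces.\<close>

lemma dyadic_orbit:
  assumes "z \<in> odometer_space" "z < 1 / 2 ^ N" "i < 2 ^ N"
  shows "(\<exists>t\<le>height N. (tower_map ^^ t) z = z + real i / 2 ^ N) \<and>
    (\<exists>t\<le>height N. (tower_map ^^ t) (z + real i / 2 ^ N) = z + 1 - 1 / 2 ^ N)"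
  using assms
proof (induction N arbitrary: z i)
  case (Suc N)
  \<comment> \<open>\<open>?w\<close> is the last base point of the first piece and
    \<open>?z'\<close> the first base point of the second.\<close>
  let ?w = "z + 1 - 1 / 2 ^ N" and ?z' = "z + 1 / 2 ^ Suc N"
  have pow: "1 / 2 ^ N = 2 * (1 / 2 ^ Suc N :: real)" "0 < (1 / 2 ^ Suc N :: real)" by auto
  have "0 < z" "z < 1" "z \<notin> \<rat>" "z < 1 / 2 ^ Suc N"
    using Suc.prems unfolding odometer_space_def by auto
  moreover from this have "z < 1 / 2 ^ N" using pow by linarith
  ultimately have z: "0 < z" "z < 1" "z \<notin> \<rat>" "z < 1 / 2 ^ Suc N" "z < 1 / 2 ^ N" .
  have le1: "1 / 2 ^ N \<le> (1 :: real)" by simp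
  have "?w \<notin> \<rat>" using irrational_add[OF z(3), of "1 - 1 / 2 ^ N"] by (simp add: algebra_simps)
  moreover have "0 < ?w" "?w < 1" using z le1 by linarith+
  ultimately have w: "?w \<in> odometer_space" by (simp add: odometer_space_def)
  have "?z' \<notin> \<rat>" using irrational_add[OF z(3), of "1 / 2 ^ Suc N"] by simp
  moreover have "0 < ?z'" "?z' < 1 / 2 ^ N" using z pow by linarith+
  moreover have "?z' < 1" using \<open>?z' < 1 / 2 ^ N\<close> le1 by linarith
  ultimately have z': "?z' \<in> odometer_space" "?z' < 1 / 2 ^ N"
    by (simp_all only: odometer_space_def mem_Collect_eq) blast
  have cell: "cell ?w = N" using z pow by (intro cell_eqI) linarith+
  have "3 / 2 ^ Suc N = 3 * (1 / 2 ^ Suc N :: real)" by simp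
  then have "odometer ?w = ?z'" using pow unfolding odometer_def cell by linarith
  with funpow_tower_map_return[OF w] have ret: "(tower_map ^^ (2 * mid N)) ?w = ?z'"
    by (simp only: cell)
  have last: "?z' + 1 - 1 / 2 ^ N = z + 1 - 1 / 2 ^ Suc N" using pow by linarith
  have N: "height N \<le> height (Suc N)" by (simp add: height_mono)
  show ?case
  proof (cases "even i")
    case True
    then obtain i' where i': "i = 2 * i'" by auto
    with Suc.prems have "i' < 2 ^ N" by simp
    have pos: "z + real i' / 2 ^ N = z + real i / 2 ^ Suc N" by (simp add: i')
    obtain t where t: "t \<le> height N" "(tower_map ^^ t) z = z + real i / 2 ^ Suc N"
      using Suc.IH[of z i'] Suc.prems(1) z \<open>i' < 2 ^ N\<close> pos by auto
    obtain u where u: "u \<le> height N" "(tower_map ^^ u) (z + real i / 2 ^ Suc N) = ?w"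
      using Suc.IH[of z i'] Suc.prems(1) z \<open>i' < 2 ^ N\<close> pos by auto
    obtain v where v: "v \<le> height N" "(tower_map ^^ v) ?z' = z + 1 - 1 / 2 ^ Suc N"
      using Suc.IH[of ?z' 0] z' last by auto
    \<comment> \<open>Finish the first piece, climb the connecting tower, then run through the whole
      second piece.\<close>
    have "(tower_map ^^ (v + (2 * mid N + u))) (z + real i / 2 ^ Suc N) = z + 1 - 1 / 2 ^ Suc N"
      by (simp only: funpow_add comp_apply u ret v)
    moreover have "v + (2 * mid N + u) \<le> height (Suc N)" using u v by (simp add: height_Suc)
    ultimately show ?thesis using t N by (meson order_trans)
  next
    case False
    then obtain i' where i': "i = 2 * i' + 1" by (auto elim: oddE)
    with Suc.prems have "i' < 2 ^ N" by simp
    have pos: "?z' + real i' / 2 ^ N = z + real i / 2 ^ Suc N" by (simp add: i' field_simps)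
    obtain u where u: "u \<le> height N" "(tower_map ^^ u) z = ?w"
      using Suc.IH[of z 0] Suc.prems(1) z by auto
    obtain t v where t: "t \<le> height N" "(tower_map ^^ t) ?z' = z + real i / 2 ^ Suc N"
      and v: "v \<le> height N" "(tower_map ^^ v) (z + real i / 2 ^ Suc N) = z + 1 - 1 / 2 ^ Suc N"
      using Suc.IH[OF z' \<open>i' < 2 ^ N\<close>] unfolding pos last by blast
    have "(tower_map ^^ (t + (2 * mid N + u))) z = z + real i / 2 ^ Suc N"
      by (simp only: funpow_add comp_apply u ret t)
    moreover have "t + (2 * mid N + u) \<le> height (Suc N)" using u t by (simp add: height_Suc)
    ultimately show ?thesis using v N by (meson order_trans)
  qed
qed (auto intro!: exI[of _ 0])

lemma dyadic_decomposition:
  assumes "x \<in> odometer_space"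
  obtains z i where "z \<in> odometer_space" "z < 1 / 2 ^ N" "i < 2 ^ N" "x = z + real i / 2 ^ N"
proof
  define i where "i = nat \<lfloor>x * 2 ^ N\<rfloor>"
  have x: "0 < x" "x < 1" "x \<notin> \<rat>" using assms by (auto simp: odometer_space_def)
  have i: "real i \<le> x * 2 ^ N" "x * 2 ^ N < real i + 1"
    using x unfolding i_def by (auto intro!: of_nat_floor simp: zero_le_mult_iff)
  show "x = x - real i / 2 ^ N + real i / 2 ^ N" by simp
  have "x - real i / 2 ^ N = (x * 2 ^ N - real i) / 2 ^ N" by (simp add: diff_divide_distrib)
  also have "\<dots> < 1 / 2 ^ N" using i by (intro divide_strict_right_mono) auto
  finally show lt: "x - real i / 2 ^ N < 1 / 2 ^ N" .
  have "x - real i / 2 ^ N \<notin> \<rat>" using irrational_add[OF x(3), of "- (real i / 2 ^ N)"] by simp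
  moreover from this have "x - real i / 2 ^ N \<noteq> 0" by auto
  moreover have "x - real i / 2 ^ N \<ge> 0" using i by (simp add: field_simps)
  moreover have "1 / 2 ^ N \<le> (1 :: real)" by simp
  moreover from this have "x - real i / 2 ^ N < 1" using lt by linarith
  ultimately show "x - real i / 2 ^ N \<in> odometer_space"
    unfolding odometer_space_def by auto
  have "x * 2 ^ N < 1 * 2 ^ N" using x by (intro mult_strict_right_mono) auto
  then have "real i < 2 ^ N" using i by linarith
  then show "i < 2 ^ N" by simp
qed

section \<open>The walk and its peaks\<close>

definition step :: "real \<Rightarrow> real" where "step y = (if level y < half y then 1 else - 1)"

definition walk :: "real \<Rightarrow> real" where
  "walk y = (if level y \<le> half y then real (level y) else 2 * real (half y) - real (level y))"

lemma walk_nonneg: "y \<in> skyscraper \<Longrightarrow> walk y \<ge> 0"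
  by (auto simp: walk_def skyscraper_def)

text \<open>\<open>walk\<close> is a tent over each tower. It is 1 on the top level and 0 on the
  base, so the return to the base counts as a downward step. Thus \<open>step\<close> is a
  coboundary, and its sums along orbits telescope.\<close>

lemma walk_tower_map:
  assumes "y \<in> skyscraper" shows "walk (tower_map y) = walk y + step y"
proof -
  from assms obtain x j where y: "y = x + real j" "x \<in> odometer_space" "j < 2 * mid (cell x)"
    by (rule skyscraperE)
  show ?thesis
  proof (cases "Suc j < 2 * mid (cell x)")
    case True
    with y show ?thesis by (auto simp: tower_map_add walk_def step_def simp del: of_nat_Suc)
  next
    case False
    with y have j: "Suc j = 2 * mid (cell x)" by linarith
    \<comment> \<open>The top level lies on the ascending branch of \<open>walk\<close> only if
      \<open>mid (cell x)\<close> is 1.\<close>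
    have "walk y = 1"
    proof (cases "j \<le> mid (cell x)")
      case True
      with j mid_pos[of "cell x"] have "j = Suc 0" by linarith
      moreover have "level y = j" "half y = mid (cell x)" using y by simp_all
      ultimately show ?thesis using True by (simp add: walk_def)
    next
      case False
      moreover have "2 * real (mid (cell x)) = real j + 1" using j by linarith
      ultimately show ?thesis using y by (simp add: walk_def)
    qed
    moreover have "step y = - 1" using j mid_pos[of "cell x"] y by (simp add: step_def)
    ultimately show ?thesis using False y odometer(1)[OF y(2)]
      by (simp add: tower_map_add walk_def)
  qed
qed

lemma sum_step_forward:
  assumes "y \<in> skyscraper"
  shows "(\<Sum>i<n. step ((tower_map ^^ i) y)) = walk ((tower_map ^^ n) y) - walk y"
  by (induction n) (use assms in \<open>auto simp: walk_tower_map funpow_tower_map_mem\<close>)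

text \<open>The iterates start at \<open>Suc 0\<close>, as in the backward products. Compared with
  forward time, \<open>walk\<close> enters with the opposite sign; as it is nonnegative, forward
  sums are at least \<open>- walk y\<close> and backward sums at most \<open>walk y\<close>.\<close>

lemma sum_step_backward:
  assumes "y \<in> skyscraper"
  shows "(\<Sum>i<n. step ((tower_map_inv ^^ Suc i) y)) = walk y - walk ((tower_map_inv ^^ n) y)"
proof (induction n)
  case (Suc n)
  have "walk ((tower_map_inv ^^ n) y)
      = walk ((tower_map_inv ^^ Suc n) y) + step ((tower_map_inv ^^ Suc n) y)"
    using walk_tower_map[OF funpow_tower_map_inv_mem[OF assms, of "Suc n"]]
      tower_map_inv(2)[OF funpow_tower_map_inv_mem[OF assms, of n]] by simp
  with Suc show ?case by simp
qed simp

lemma walk_peak: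
  assumes "x \<in> odometer_space"
  shows "walk (x + real (mid (cell x))) = real (mid (cell x))"
  using assms by (simp add: walk_def)

text \<open>Once in the base at time \<open>t0\<close>, the orbit needs at most
  \<open>height N\<close> steps to a base point above \<open>1 - 1 / 2 ^ N\<close>. The interval
  containing it has an index of at least \<open>N\<close>, and climbing half its tower leads to the
  peak.\<close>

lemma forward_peak:
  assumes "y \<in> skyscraper"
  shows "\<exists>t0. \<forall>N. \<exists>t k. t \<le> t0 + height N \<and> N \<le> k \<and> walk ((tower_map ^^ (t + mid k)) y) = real (mid k)"
proof -
  from tower_map_returns[OF assms] obtain t0 where t0: "(tower_map ^^ t0) y \<in> odometer_space" ..
  show ?thesis
  proof (rule exI[of _ t0], rule allI)
    fix N
    obtain z i where z: "z \<in> odometer_space" "z < 1 / 2 ^ N" "i < 2 ^ N"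
      "(tower_map ^^ t0) y = z + real i / 2 ^ N" by (rule dyadic_decomposition[OF t0])
    then obtain t where t: "t \<le> height N" "(tower_map ^^ t) ((tower_map ^^ t0) y) = z + 1 - 1 / 2 ^ N"
      using dyadic_orbit[of z N i] by auto
    let ?w = "z + 1 - 1 / 2 ^ N"
    have z01: "0 < z" "z \<notin> \<rat>" using z by (auto simp: odometer_space_def)
    have "?w \<notin> \<rat>" using irrational_add[OF z01(2), of "1 - 1 / 2 ^ N"] by (simp add: algebra_simps)
    moreover have "1 / 2 ^ N \<le> (1 :: real)" by simp
    then have "0 < ?w" "?w < 1" "1 - 1 / 2 ^ N \<le> ?w" using z z01 by linarith+
    ultimately have w: "?w \<in> odometer_space" "N \<le> cell ?w"
      by (auto simp: odometer_space_def intro: cell_ge)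
    have "(tower_map ^^ ((t + t0) + mid (cell ?w))) y
        = (tower_map ^^ mid (cell ?w)) ((tower_map ^^ t) ((tower_map ^^ t0) y))"
      by (subst add.commute[of _ "mid _"]) (simp only: funpow_add comp_apply)
    also have "\<dots> = ?w + real (mid (cell ?w))"
      using w by (simp add: t funpow_tower_map_base)
    finally have "walk ((tower_map ^^ ((t + t0) + mid (cell ?w))) y) = real (mid (cell ?w))"
      using walk_peak[OF w(1)] by simp
    then show "\<exists>t k. t \<le> t0 + height N \<and> N \<le> k \<and> walk ((tower_map ^^ (t + mid k)) y) = real (mid k)"
      using w t by (intro exI[of _ "t + t0"] exI[of _ "cell ?w"]) auto
  qed
qed

text \<open>Backward in time, the orbit reaches a base point below \<open>1 / 2 ^ N\<close> by
  reversing the piece that counts up from it. The preimage of that point under the odometer has an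
  index of at least \<open>N\<close>, and its tower is entered from the top.\<close>

lemma backward_peak:
  assumes "y \<in> skyscraper"
  shows "\<exists>t0. \<forall>N. \<exists>t k. t \<le> t0 + height N \<and> N \<le> k \<and> walk ((tower_map_inv ^^ (t + mid k)) y) = real (mid k)"
proof -
  from tower_map_inv_returns[OF assms] obtain t0 where t0: "(tower_map_inv ^^ t0) y \<in> odometer_space" ..
  show ?thesis
  proof (rule exI[of _ t0], rule allI)
    fix N
    obtain z i where z: "z \<in> odometer_space" "z < 1 / 2 ^ N" "i < 2 ^ N"
      "(tower_map_inv ^^ t0) y = z + real i / 2 ^ N" by (rule dyadic_decomposition[OF t0])
    then obtain t where t: "t \<le> height N" "(tower_map ^^ t) z = (tower_map_inv ^^ t0) y"
      using dyadic_orbit[of z N i] by auto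
    then have t': "(tower_map_inv ^^ t) ((tower_map_inv ^^ t0) y) = z"
      using funpow_tower_map_inv_tower_map[of z t] z odometer_space_subset by auto
    let ?k = "cell (1 - z)" and ?x = "odometer_inv z"
    have "N \<le> ?k" using z by (intro cell_ge) (auto simp: odometer_space_def)
    have x: "?x \<in> odometer_space" "cell ?x = ?k" using odometer_inv[OF z(1)] by auto
    \<comment> \<open>The first step lands on the top level \<open>2 * mid ?k - 1\<close>, and the
      other \<open>mid ?k - 1\<close> steps descend to level \<open>mid ?k\<close>.\<close>
    have "mid ?k = Suc (mid ?k - 1)" using mid_pos[of ?k] by linarith
    then have "(tower_map_inv ^^ mid ?k) z = (tower_map_inv ^^ (mid ?k - 1)) (tower_map_inv z)"
      by (metis funpow_Suc_right comp_apply)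
    also have "\<dots> = ?x + real (2 * mid ?k - 1 - (mid ?k - 1))"
      using z x by (simp add: tower_map_inv_base funpow_tower_map_inv_level del: of_nat_diff)
    also have "2 * mid ?k - 1 - (mid ?k - 1) = mid ?k" using mid_pos[of ?k] by linarith
    finally have m: "(tower_map_inv ^^ mid ?k) z = ?x + real (mid ?k)" .
    have "(tower_map_inv ^^ ((t + t0) + mid ?k)) y
        = (tower_map_inv ^^ mid ?k) ((tower_map_inv ^^ t) ((tower_map_inv ^^ t0) y))"
      by (subst add.commute[of _ "mid _"]) (simp only: funpow_add comp_apply)
    then have "walk ((tower_map_inv ^^ ((t + t0) + mid ?k)) y) = real (mid ?k)"
      using walk_peak[OF x(1)] x(2) by (simp add: t' m)
    then show "\<exists>t k. t \<le> t0 + height N \<and> N \<le> k \<and> walk ((tower_map_inv ^^ (t + mid k)) y) = real (mid k)"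
      using \<open>N \<le> ?k\<close> t by (intro exI[of _ "t + t0"] exI[of _ ?k]) auto
  qed
qed

section \<open>Invariant measure, conservativity and ergodicity\<close>

text \<open>For a wandering set \<open>W\<close>, the points of \<open>W\<close> that
  \<open>U ^^ n\<close> sends into \<open>Y\<close> have the same mass as a part of
  \<open>Y\<close>, and these parts are disjoint. So the masses are summable, and by Borel-Cantelli
  almost no point of \<open>W\<close> visits \<open>Y\<close> infinitely often, although all points
  do.\<close>

lemma conservative_if_returns_to_finite:
  assumes T [measurable]: "T \<in> measurable \<Omega> \<Omega>" and U [measurable]: "U \<in> measurable \<Omega> \<Omega>"
    and pres: "\<And>A. A \<in> sets \<Omega> \<Longrightarrow> emeasure \<Omega> (U -` A \<inter> space \<Omega>) = emeasure \<Omega> A"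
    and inv: "\<And>\<omega>. \<omega> \<in> space \<Omega> \<Longrightarrow> T (U \<omega>) = \<omega>"
    and Y [measurable]: "Y \<in> sets \<Omega>" and fin: "emeasure \<Omega> Y < \<infinity>"
    and ret: "\<And>\<omega>. \<omega> \<in> space \<Omega> \<Longrightarrow> \<exists>t. (U ^^ t) \<omega> \<in> Y"
  shows "conservative_transformation \<Omega> T"
  unfolding conservative_transformation_def
proof (intro conjI notI T)
  assume "\<exists>W\<in>sets \<Omega>. 0 < emeasure \<Omega> W \<and> disjoint_family (\<lambda>n::nat. (T ^^ n) -` W \<inter> space \<Omega>)"
  then obtain W where W [measurable]: "W \<in> sets \<Omega>" and pos: "0 < emeasure \<Omega> W"
    and disj: "disjoint_family (\<lambda>n::nat. (T ^^ n) -` W \<inter> space \<Omega>)" by auto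
  have U_space: "(U ^^ n) \<omega> \<in> space \<Omega>" if "\<omega> \<in> space \<Omega>" for n \<omega>
    using that by (induction n) (auto intro: measurable_space[OF U])
  have TU: "(T ^^ n) ((U ^^ n) \<omega>) = \<omega>" if "\<omega> \<in> space \<Omega>" for n \<omega>
    using that
  proof (induction n)
    case (Suc n)
    then show ?case by (subst funpow_Suc_right) (simp add: inv U_space)
  qed simp
  have meas [measurable]: "(T ^^ n) \<in> measurable \<Omega> \<Omega>" "(U ^^ n) \<in> measurable \<Omega> \<Omega>" for n
    by (intro measurable_compose_n T U)+
  have pres_n: "emeasure \<Omega> ((U ^^ n) -` A \<inter> space \<Omega>) = emeasure \<Omega> A" if A: "A \<in> sets \<Omega>" for n A
  proof (induction n)
    case 0
    show ?case using A by (simp add: Int_absorb2 sets.sets_into_space)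
  next
    case (Suc n)
    have eq: "(U ^^ Suc n) -` A \<inter> space \<Omega> = U -` ((U ^^ n) -` A \<inter> space \<Omega>) \<inter> space \<Omega>"
      using measurable_space[OF U] by (subst funpow_Suc_right) auto
    show ?case
      by (simp only: eq pres[OF measurable_sets[OF meas(2) A]] Suc)
  qed
  define A where "A n = W \<inter> ((U ^^ n) -` Y \<inter> space \<Omega>)" for n
  have A_sets [measurable]: "A n \<in> sets \<Omega>" for n unfolding A_def by measurable
  let ?B = "\<lambda>n. ((T ^^ n) -` W \<inter> space \<Omega>) \<inter> Y"
  have A_eq: "emeasure \<Omega> (A n) = emeasure \<Omega> (?B n)" for n
  proof -
    have eq: "A n = (U ^^ n) -` ?B n \<inter> space \<Omega>"
      using sets.sets_into_space[OF W] by (auto simp: A_def TU U_space)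
    show ?thesis unfolding eq by (rule pres_n) measurable
  qed
  have "(\<Sum>n. emeasure \<Omega> (A n)) = emeasure \<Omega> (\<Union>n. ?B n)"
    unfolding A_eq using disj by (intro suminf_emeasure) (auto simp: disjoint_family_on_def)
  also have "\<dots> \<le> emeasure \<Omega> Y" by (intro emeasure_mono) auto
  finally have sum: "(\<Sum>n. emeasure \<Omega> (A n)) < \<infinity>" using fin by auto
  have A_fin: "emeasure \<Omega> (A n) < \<infinity>" for n
    using emeasure_mono[of "?B n" Y \<Omega>] fin unfolding A_eq by (auto intro: order_le_less_trans)
  have "summable (\<lambda>n. measure \<Omega> (A n))"
    using sum A_fin by (intro summable_suminf_not_top) (auto simp: emeasure_eq_ennreal_measure less_top)
  from borel_cantelli_AE1[OF A_sets A_fin this]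
  have "AE \<omega> in \<Omega>. \<omega> \<notin> W"
  proof eventually_elim
    fix \<omega> assume "\<forall>\<^sub>F n in sequentially. \<omega> \<in> space \<Omega> - A n"
    then obtain N where N: "\<And>n. n \<ge> N \<Longrightarrow> \<omega> \<in> space \<Omega> - A n"
      by (auto simp: eventually_sequentially)
    then have \<omega>: "\<omega> \<in> space \<Omega>" by blast
    obtain t where "(U ^^ t) ((U ^^ N) \<omega>) \<in> Y" using ret[OF U_space[OF \<omega>]] by auto
    then have "(U ^^ (t + N)) \<omega> \<in> Y" by (simp add: funpow_add)
    then show "\<omega> \<notin> W" using N[of "t + N"] \<omega> by (auto simp: A_def)
  qed
  then have "emeasure \<Omega> W = 0"
    using W sets.sets_into_space[OF W] by (subst (asm) AE_iff_measurable[of W]) auto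
  with pos show False by simp
qed

text \<open>\<open>\<iota>\<close> cuts the space into countably many pieces on each of which
  \<open>T\<close> is a translation, so translation invariance of Lebesgue measure applies piece by
  piece.\<close>

lemma emeasure_piecewise_translation:
  fixes T U :: "real \<Rightarrow> real" and \<iota> :: "real \<Rightarrow> nat" and c :: "nat \<Rightarrow> real"
  assumes [measurable]: "X \<in> sets borel" "A \<in> sets borel" "T \<in> borel_measurable borel"
      "U \<in> borel_measurable borel" "\<iota> \<in> measurable borel (count_space UNIV)"
    and A: "A \<subseteq> X"
    and U: "\<And>y. y \<in> X \<Longrightarrow> U y \<in> X" "\<And>y. y \<in> X \<Longrightarrow> T (U y) = y" "\<And>y. y \<in> X \<Longrightarrow> U (T y) = y"
    and c: "\<And>y. y \<in> X \<Longrightarrow> T y = y + c (\<iota> y)"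
  shows "emeasure lborel (T -` A \<inter> X) = emeasure lborel A"
proof -
  define P where "P n = {y \<in> X. \<iota> y = n \<and> T y \<in> A}" for n
  define Q where "Q n = {y \<in> A. \<iota> (U y) = n}" for n
  have [measurable]: "P n \<in> sets borel" "Q n \<in> sets borel" for n unfolding P_def Q_def by measurable
  have PQ: "P n = (+) (c n) -` Q n" for n
  proof (intro set_eqI iffI)
    fix y assume "y \<in> P n"
    then show "y \<in> (+) (c n) -` Q n"
      using c[of y] U(3)[of y] by (auto simp: P_def Q_def add.commute)
  next
    fix y assume "y \<in> (+) (c n) -` Q n"
    then have y: "y + c n \<in> A" "\<iota> (U (y + c n)) = n" by (auto simp: Q_def add.commute)
    then have X: "y + c n \<in> X" using A by auto
    have "y + c n = U (y + c n) + c n" using c[OF U(1)[OF X]] U(2)[OF X] y by simp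
    then have "U (y + c n) = y" by simp
    then show "y \<in> P n" using U(1,2)[OF X] y by (simp add: P_def)
  qed
  have "emeasure lborel (P n) = emeasure lborel (Q n)" for n
  proof -
    have "emeasure lborel (Q n) = emeasure (distr lborel borel ((+) (c n))) (Q n)"
      by (simp add: lborel_distr_plus)
    also have "\<dots> = emeasure lborel (P n)" by (subst emeasure_distr) (auto simp: PQ)
    finally show ?thesis by simp
  qed
  then have "(\<Sum>n. emeasure lborel (P n)) = (\<Sum>n. emeasure lborel (Q n))" by simp
  moreover have "(\<Sum>n. emeasure lborel (P n)) = emeasure lborel (\<Union>n. P n)"
    by (intro suminf_emeasure) (auto simp: disjoint_family_on_def P_def)
  moreover have "(\<Sum>n. emeasure lborel (Q n)) = emeasure lborel (\<Union>n. Q n)"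
    by (intro suminf_emeasure) (auto simp: disjoint_family_on_def Q_def)
  moreover have "(\<Union>n. P n) = T -` A \<inter> X" "(\<Union>n. Q n) = A" by (auto simp: P_def Q_def)
  ultimately show ?thesis by simp
qed

section \<open>Measurability, and Lebesgue measure on the skyscraper\<close>

lemma measurable_cell [measurable]: "cell \<in> measurable borel (count_space UNIV)"
  unfolding cell_def[abs_def] by measurable

lemma measurable_frac [measurable]: "(frac :: real \<Rightarrow> real) \<in> borel_measurable borel"
  unfolding frac_def[abs_def] by measurable

lemma measurable_level [measurable]: "level \<in> measurable borel (count_space UNIV)"
  unfolding level_def[abs_def] by measurable

lemma measurable_half [measurable]: "half \<in> measurable borel (count_space UNIV)"
  unfolding half_def[abs_def] by measurable

lemma measurable_tower_map [measurable]: "tower_map \<in> borel_measurable borel"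
  unfolding tower_map_def[abs_def] odometer_def by measurable

lemma measurable_tower_map_inv [measurable]: "tower_map_inv \<in> borel_measurable borel"
  unfolding tower_map_inv_def[abs_def] odometer_inv_def by measurable

lemma pred_less_nat [measurable (raw)]:
  fixes f g :: "'a \<Rightarrow> nat"
  assumes [measurable]: "f \<in> measurable M (count_space UNIV)" "g \<in> measurable M (count_space UNIV)"
  shows "Measurable.pred M (\<lambda>x. f x < g x)"
proof -
  have "(\<lambda>x. f x < g x) = (\<lambda>x. \<exists>i k. f x = i \<and> g x = k \<and> i < k)" by auto
  also have "Measurable.pred M \<dots>" by measurable
  finally show ?thesis .
qed

lemma borel_Rats [simp, measurable]: "(\<rat> :: real set) \<in> sets borel"
  by (rule sets.countable) (auto simp: countable_rat)

lemma borel_skyscraper [measurable]: "skyscraper \<in> sets borel"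
proof -
  have "skyscraper = {y. 0 < y \<and> level y < 2 * half y} - \<rat>" by (auto simp: skyscraper_def)
  also have "\<dots> \<in> sets borel" by (intro sets.Diff borel_Rats) measurable
  finally show ?thesis .
qed

lemma odometer_space_eq: "odometer_space = {0<..<1} - \<rat>"
  by (auto simp: odometer_space_def)

lemma borel_odometer_space [measurable]: "odometer_space \<in> sets borel"
  unfolding odometer_space_eq by measurable

lemma null_sets_Rats: "(\<rat> :: real set) \<in> null_sets lborel"
  by (rule countable_imp_null_set_lborel[OF countable_rat])

definition tower_measure :: "real measure" where
  "tower_measure = restrict_space lborel skyscraper"

lemma space_tower_measure [simp]: "space tower_measure = skyscraper"
  by (simp add: tower_measure_def space_restrict_space)

lemma sets_tower_measure: "A \<in> sets tower_measure \<longleftrightarrow> A \<subseteq> skyscraper \<and> A \<in> sets borel"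
  by (simp add: tower_measure_def sets_restrict_space_iff)

lemma emeasure_tower_measure: "A \<subseteq> skyscraper \<Longrightarrow> emeasure tower_measure A = emeasure lborel A"
  by (simp add: tower_measure_def emeasure_restrict_space)

lemma measurable_tower_measure:
  "f \<in> measurable borel M \<Longrightarrow> f \<in> measurable tower_measure M"
  unfolding tower_measure_def by (intro measurable_restrict_space1) simp

lemma measurable_tower_measure2:
  assumes "f \<in> borel_measurable borel" "\<And>y. y \<in> skyscraper \<Longrightarrow> f y \<in> skyscraper"
  shows "f \<in> measurable tower_measure tower_measure"
proof -
  have "f \<in> measurable tower_measure lborel" using assms(1) by (simp add: measurable_tower_measure)
  then show ?thesis
    unfolding tower_measure_def measurable_restrict_space2_iff
    using assms(2) by (auto simp: space_restrict_space)
qed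

lemma tower_map_measurable: "tower_map \<in> measurable tower_measure tower_measure"
  by (rule measurable_tower_measure2) (auto simp: tower_map)

lemma tower_map_inv_measurable: "tower_map_inv \<in> measurable tower_measure tower_measure"
  by (rule measurable_tower_measure2) (auto simp: tower_map_inv)

lemma sigma_finite_tower_measure: "sigma_finite_measure tower_measure"
  unfolding tower_measure_def
  by (rule sigma_finite_measure_restrict_space) (simp_all add: sigma_finite_lborel)

lemma bij_betw_tower_map: "bij_betw tower_map skyscraper skyscraper"
  by (rule bij_betw_byWitness[of _ tower_map_inv]) (auto simp: tower_map tower_map_inv)

lemma inverse_map_tower_map: "y \<in> skyscraper \<Longrightarrow> inverse_map tower_measure tower_map y = tower_map_inv y"
  unfolding inverse_map_def space_tower_measure
  by (rule inv_into_f_eq) (auto simp: bij_betw_imp_inj_on[OF bij_betw_tower_map] tower_map_inv)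

lemma invertible_tower_map: "invertible_transformation tower_measure tower_map"
  unfolding invertible_transformation_def
  using tower_map_measurable bij_betw_tower_map
    measurable_cong[of tower_measure "inverse_map tower_measure tower_map" tower_map_inv tower_measure]
    inverse_map_tower_map tower_map_inv_measurable
  by simp

lemma emeasure_vimage_tower_map:
  assumes "A \<subseteq> skyscraper" "A \<in> sets borel"
  shows "emeasure lborel (tower_map -` A \<inter> skyscraper) = emeasure lborel A"
proof -
  \<comment> \<open>Label 0 stands for climbing one level, and label \<open>Suc k\<close> for
    leaving the top of a tower over the \<open>k\<close>-th interval. In the latter case the shift
    undoes \<open>2 * mid k - 1\<close> levels and applies the odometer, which itself adds
    \<open>3 / 2 ^ Suc k - 1\<close>.\<close>
  define \<iota> where "\<iota> y = (if Suc (level y) < 2 * half y then 0 else Suc (cell (frac y)))" for y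
  define c :: "nat \<Rightarrow> real"
    where "c n = (case n of 0 \<Rightarrow> 1 | Suc k \<Rightarrow> 3 / 2 ^ Suc k - 2 * real (mid k))" for n
  have [measurable]: "\<iota> \<in> measurable borel (count_space UNIV)"
    unfolding \<iota>_def by measurable
  show ?thesis
  proof (rule emeasure_piecewise_translation[where U = tower_map_inv and \<iota> = \<iota> and c = c])
    fix y assume "y \<in> skyscraper"
    then obtain x j where y: "y = x + real j" "x \<in> odometer_space" "j < 2 * mid (cell x)"
      by (rule skyscraperE)
    show "tower_map y = y + c (\<iota> y)"
    proof (cases "Suc j < 2 * mid (cell x)")
      case True
      with y show ?thesis by (simp add: tower_map_add \<iota>_def c_def)
    next
      case False
      with y have "2 * real (mid (cell x)) = real j + 1" by linarith
      with False y show ?thesis by (simp add: tower_map_add \<iota>_def c_def odometer_def)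
    qed
  qed (use assms in \<open>auto simp: tower_map tower_map_inv\<close>)
qed

lemma measure_preserving_tower_map: "measure_preserving_transformation tower_measure tower_map"
  unfolding measure_preserving_transformation_def
  using tower_map_measurable
  by (auto simp: sets_tower_measure emeasure_tower_measure emeasure_vimage_tower_map)

lemma emeasure_vimage_tower_map_inv:
  assumes "A \<subseteq> skyscraper" "A \<in> sets borel"
  shows "emeasure lborel (tower_map_inv -` A \<inter> skyscraper) = emeasure lborel A"
proof -
  let ?B = "tower_map_inv -` A \<inter> skyscraper"
  have "?B \<in> sets borel" using assms by measurable
  then have "emeasure lborel (tower_map -` ?B \<inter> skyscraper) = emeasure lborel ?B"
    by (intro emeasure_vimage_tower_map) auto
  moreover have "tower_map -` ?B \<inter> skyscraper = A" using assms(1) by (auto simp: tower_map)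
  ultimately show ?thesis by simp
qed

lemma emeasure_odometer_space: "emeasure lborel odometer_space = 1"
  unfolding odometer_space_eq by (simp add: emeasure_Diff_null_set[OF null_sets_Rats])

lemma conservative_tower_map: "conservative_transformation tower_measure tower_map"
proof (rule conservative_if_returns_to_finite[OF tower_map_measurable tower_map_inv_measurable])
  have sub: "odometer_space \<subseteq> skyscraper" by (auto intro: odometer_space_subset)
  then show "odometer_space \<in> sets tower_measure" "emeasure tower_measure odometer_space < \<infinity>"
    by (simp_all add: sets_tower_measure emeasure_tower_measure emeasure_odometer_space)
qed (auto simp: sets_tower_measure emeasure_tower_measure emeasure_vimage_tower_map_inv
      tower_map_inv tower_map_inv_returns)

text \<open>The part over the \<open>k\<close>-th interval has mass at least 1 for every
  \<open>k\<close>.\<close>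

lemma emeasure_skyscraper: "emeasure lborel skyscraper = \<infinity>"
proof -
  define F where "F = (\<lambda>(k, j). {y. level y = j \<and> cell (frac y) = k} \<inter> skyscraper)"
  have [measurable]: "F p \<in> sets borel" for p
    unfolding F_def by (cases p) simp
  have F: "1 / 2 ^ Suc k \<le> emeasure lborel (F (k, j))" if "j < 2 * 2 ^ k" for k j
  proof -
    let ?I = "{1 - 1 / 2 ^ k + real j <..< 1 - 1 / 2 ^ Suc k + real j}"
    have pow: "1 / 2 ^ k = 2 * (1 / 2 ^ Suc k :: real)" "0 < (1 / 2 ^ Suc k :: real)" by auto
    have "?I - \<rat> \<subseteq> F (k, j)"
    proof
      fix y assume y: "y \<in> ?I - \<rat>"
      define x where "x = y - real j"
      have "1 / 2 ^ k \<le> (1 :: real)" by simp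
      with y pow have x: "1 - 1 / 2 ^ k \<le> x" "x < 1 - 1 / 2 ^ Suc k" "0 < x" "x < 1"
        unfolding x_def greaterThanLessThan_iff Diff_iff by linarith+
      have "x \<notin> \<rat>" using irrational_add[of y "- real j"] y by (simp add: x_def)
      with x have X: "x \<in> odometer_space" "cell x = k"
        by (auto simp: odometer_space_def intro: cell_eqI)
      have "j < 2 * mid (cell x)" using that power2_le_mid[of k] X by simp
      then have "x + real j \<in> F (k, j)" using X by (simp add: F_def)
      then show "y \<in> F (k, j)" by (simp add: x_def)
    qed
    then have "emeasure lborel (?I - \<rat>) \<le> emeasure lborel (F (k, j))"
      by (intro emeasure_mono) auto
    moreover have "emeasure lborel (?I - \<rat>) = ennreal (1 / 2 ^ Suc k)"
    proof -
      have "1 - 1 / 2 ^ k + real j \<le> 1 - 1 / 2 ^ Suc k + real j"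
        and "1 - 1 / 2 ^ Suc k + real j - (1 - 1 / 2 ^ k + real j) = 1 / 2 ^ Suc k"
        using pow by linarith+
      then show ?thesis
        by (simp add: emeasure_Diff_null_set[OF null_sets_Rats] del: power_Suc)
    qed
    moreover have "ennreal (1 / 2 ^ Suc k) = 1 / 2 ^ Suc k"
      by (simp add: divide_ennreal[symmetric] ennreal_power[symmetric] del: power_Suc)
    ultimately show ?thesis by simp
  qed
  have "of_nat n \<le> emeasure lborel skyscraper" for n
  proof -
    let ?I = "Sigma {..<n} (\<lambda>k. {..< 2 ^ Suc k :: nat})"
    have "of_nat n = (\<Sum>k<n. \<Sum>j < (2 ^ Suc k :: nat). 1 / 2 ^ Suc k :: ennreal)"
      by (simp add: ennreal_times_divide ennreal_divide_self power_less_top_ennreal del: power_Suc)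
    also have "\<dots> = (\<Sum>(k, j)\<in>?I. 1 / 2 ^ Suc k)" by (rule sum.Sigma) auto
    also have "\<dots> \<le> (\<Sum>p\<in>?I. emeasure lborel (F p))" using F by (intro sum_mono) auto
    also have "\<dots> = emeasure lborel (\<Union>p\<in>?I. F p)"
      by (intro sum_emeasure) (auto simp: disjoint_family_on_def F_def)
    also have "\<dots> \<le> emeasure lborel skyscraper"
      by (intro emeasure_mono) (auto simp: F_def)
    finally show ?thesis .
  qed
  then show ?thesis
    by (metis ennreal_Ex_less_of_nat infinity_ennreal_def leD top.not_eq_extremum)
qed

section \<open>Ergodicity\<close>

lemma emeasure_invariant_dyadic:
  assumes A [measurable]: "A \<in> sets borel"
    and inv: "\<And>y. y \<in> skyscraper \<Longrightarrow> tower_map y \<in> A \<longleftrightarrow> y \<in> A"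
    and i: "i < 2 ^ N"
  shows "emeasure lborel (A \<inter> odometer_space \<inter> {real i / 2 ^ N <..< real (Suc i) / 2 ^ N})
    = emeasure lborel (A \<inter> odometer_space \<inter> {0 <..< 1 / 2 ^ N})" (is "emeasure lborel ?L = emeasure lborel ?R")
proof -
  have inv_n: "(tower_map ^^ n) y \<in> A \<longleftrightarrow> y \<in> A" if "y \<in> skyscraper" for n y
    using that by (induction n) (auto simp: inv funpow_tower_map_mem)
  have pos: "0 < (1 / 2 ^ N :: real)" "1 / 2 ^ N \<le> (1 :: real)" by simp_all
  \<comment> \<open>Both points lie on one orbit, so an invariant set cannot tell them apart; hence
    its traces on dyadic intervals of equal length are translates of each other.\<close>
  have shift: "z \<in> A \<longleftrightarrow> z + real i / 2 ^ N \<in> A" if "z \<in> odometer_space" "z < 1 / 2 ^ N" for z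
  proof -
    from dyadic_orbit[OF that i] obtain t where "(tower_map ^^ t) z = z + real i / 2 ^ N" by auto
    with inv_n[OF odometer_space_subset[OF that(1)], of t] show ?thesis by simp
  qed
  have Suc: "real (Suc i) / 2 ^ N = 1 / 2 ^ N + real i / 2 ^ N"
    by (simp add: add_divide_distrib)
  have "real (Suc i) \<le> real (2 ^ N)" using i by (simp only: of_nat_le_iff)
  then have le1: "real (Suc i) / 2 ^ N \<le> 1" by simp
  have "?R = (+) (real i / 2 ^ N) -` ?L"
  proof (intro set_eqI iffI)
    fix z assume z: "z \<in> ?R"
    then have z': "0 < z" "z < 1 / 2 ^ N" "z \<in> odometer_space" "z \<notin> \<rat>"
      by (auto simp: odometer_space_def)
    have r: "real i / 2 ^ N < z + real i / 2 ^ N" "z + real i / 2 ^ N < real (Suc i) / 2 ^ N"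
      using z' Suc by linarith+
    have "0 \<le> real i / 2 ^ N" by simp
    with r le1 have "0 < z + real i / 2 ^ N" "z + real i / 2 ^ N < 1" by linarith+
    then have "z + real i / 2 ^ N \<in> odometer_space"
      using irrational_add[OF z'(4), of "real i / 2 ^ N"] by (simp add: odometer_space_def)
    then show "z \<in> (+) (real i / 2 ^ N) -` ?L"
      using z shift[OF z'(3,2)] r by (simp add: add.commute del: of_nat_Suc)
  next
    fix z assume "z \<in> (+) (real i / 2 ^ N) -` ?L"
    then have z: "z + real i / 2 ^ N \<in> A" "z + real i / 2 ^ N \<notin> \<rat>"
      "real i / 2 ^ N < z + real i / 2 ^ N" "z + real i / 2 ^ N < real (Suc i) / 2 ^ N"
      by (auto simp: odometer_space_def add.commute)
    then have z': "0 < z" "z < 1 / 2 ^ N" using Suc by linarith+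
    moreover have "z \<notin> \<rat>" using z(2) by (metis Rats_add Rats_divide Rats_number_of Rats_of_nat Rats_power)
    moreover have "z < 1" using z' pos by linarith
    ultimately have "z \<in> odometer_space" by (simp add: odometer_space_def)
    then show "z \<in> ?R" using z' z(1) shift by simp
  qed
  then have "emeasure lborel ?R = emeasure (distr lborel borel ((+) (real i / 2 ^ N))) ?L"
    by (subst emeasure_distr) auto
  then show ?thesis by (simp add: lborel_distr_plus)
qed

text \<open>The trace of \<open>A\<close> has the same mass in all dyadic intervals of one length,
  so its distribution function is linear at the dyadic points and, by monotonicity, on the whole
  unit interval.\<close>

lemma measure_invariant_atLeast:
  fixes x :: real
  assumes A [measurable]: "A \<in> sets borel"
    and inv: "\<And>y. y \<in> skyscraper \<Longrightarrow> tower_map y \<in> A \<longleftrightarrow> y \<in> A"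
    and x: "0 \<le> x" "x \<le> 1"
  shows "measure lborel (A \<inter> odometer_space \<inter> {..x}) = x * measure lborel (A \<inter> odometer_space)"
proof -
  let ?B = "A \<inter> odometer_space"
  define F where "F x = measure lborel (?B \<inter> {..x})" for x
  define a where "a = measure lborel ?B"
  have fin: "C \<in> fmeasurable lborel" if "C \<subseteq> ?B" "C \<in> sets borel" for C
  proof (rule fmeasurableI2)
    show "odometer_space \<in> fmeasurable lborel"
      by (simp add: fmeasurable_def emeasure_odometer_space)
  qed (use that in auto)
  have mono: "F x \<le> F y" if "x \<le> y" for x y
    unfolding F_def using that by (intro measure_mono_fmeasurable fin) auto
  have step: "F (real (Suc i) / 2 ^ N) = F (real i / 2 ^ N) + F (1 / 2 ^ N)" if "i < 2 ^ N" for i N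
  proof -
    let ?I = "?B \<inter> {real i / 2 ^ N <..< real (Suc i) / 2 ^ N}"
    have le: "real i / 2 ^ N \<le> real (Suc i) / 2 ^ N" by (intro divide_right_mono) auto
    have notin: "q \<notin> ?B" if "q \<in> \<rat>" for q using that by (auto simp: odometer_space_def)
    have "?B \<inter> {..real (Suc i) / 2 ^ N} = (?B \<inter> {..real i / 2 ^ N}) \<union> ?I"
      using le notin[of "real (Suc i) / 2 ^ N"] by (auto simp: not_le order_le_less)
    then have "F (real (Suc i) / 2 ^ N) = F (real i / 2 ^ N) + measure lborel ?I"
      unfolding F_def by (simp only:) (rule measure_Un_AE, auto intro!: fin)
    also have "measure lborel ?I = measure lborel (?B \<inter> {0 <..< 1 / 2 ^ N})"
      using emeasure_invariant_dyadic[OF A inv that] by (simp add: measure_def)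
    also have "?B \<inter> {0 <..< 1 / 2 ^ N} = ?B \<inter> {..1 / 2 ^ N}"
      using notin[of "1 / 2 ^ N"] by (auto simp: odometer_space_def order_le_less)
    finally show ?thesis by (simp add: F_def)
  qed
  have F0: "F 0 = 0"
  proof -
    have "?B \<inter> {..0} = {}" by (auto simp: odometer_space_def)
    then show ?thesis by (simp add: F_def)
  qed
  have F_dyadic: "F (real i / 2 ^ N) = real i * F (1 / 2 ^ N)" if "i \<le> 2 ^ N" for i N
    using that by (induction i) (simp_all add: F0 step algebra_simps del: of_nat_Suc, simp add: algebra_simps)
  have F1: "F 1 = a"
  proof -
    have "?B \<inter> {..1} = ?B" by (auto simp: odometer_space_def)
    then show ?thesis by (simp add: F_def a_def)
  qed
  have F_unit: "F (1 / 2 ^ N) = a / 2 ^ N" for N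
    using F_dyadic[of "2 ^ N" N] F1 by simp
  have dyadic: "F (real i / 2 ^ N) = a * (real i / 2 ^ N)" if "i \<le> 2 ^ N" for i N
    using F_dyadic[OF that] F_unit by simp
  have a0: "a \<ge> 0" by (simp add: a_def)
  show ?thesis
  \<comment> \<open>The end point is treated apart, because its right dyadic neighbour would lie
    outside the unit interval.\<close>
  proof (cases "x = 1")
    case True
    then show ?thesis using F1 by (simp add: F_def a_def)
  next
    case False
    with x have x1: "x < 1" by simp
    \<comment> \<open>Both \<open>F x\<close> and \<open>a * x\<close> lie between the values of
      \<open>F\<close> at the two dyadic neighbours of \<open>x\<close>, which differ by
      \<open>a / 2 ^ N\<close>.\<close>
    have bound: "\<bar>F x - a * x\<bar> \<le> a * (1 / 2) ^ N" for N
    proof -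
      define i where "i = nat \<lfloor>x * 2 ^ N\<rfloor>"
      have i: "real i \<le> x * 2 ^ N" "x * 2 ^ N < real i + 1"
        using x unfolding i_def by (auto intro!: of_nat_floor)
      have "x * 2 ^ N < 1 * 2 ^ N" using x1 by (intro mult_strict_right_mono) auto
      then have "real i < 2 ^ N" using i by linarith
      then have lt: "i < 2 ^ N" by simp
      have xi: "real i / 2 ^ N \<le> x" "x \<le> real (Suc i) / 2 ^ N"
        using i by (simp_all add: field_simps)
      have Suc: "real (Suc i) / 2 ^ N = real i / 2 ^ N + (1 / 2) ^ N"
        by (simp add: add_divide_distrib power_divide)
      have "F x \<le> a * (real i / 2 ^ N) + a * (1 / 2) ^ N" "a * (real i / 2 ^ N) \<le> F x"
        using mono[OF xi(1)] mono[OF xi(2)] dyadic[of i N] dyadic[of "Suc i" N] lt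
        by (simp_all add: Suc distrib_left del: of_nat_Suc)
      moreover have "a * x \<le> a * (real i / 2 ^ N) + a * (1 / 2) ^ N" "a * (real i / 2 ^ N) \<le> a * x"
        using mult_left_mono[OF xi(1) a0] mult_left_mono[OF xi(2) a0]
        by (simp_all add: Suc distrib_left del: of_nat_Suc)
      ultimately show ?thesis by linarith
    qed
    have "(\<lambda>N. a * (1 / 2) ^ N) \<longlonglongrightarrow> a * 0"
      by (intro tendsto_intros LIMSEQ_power_zero) auto
    then have "\<bar>F x - a * x\<bar> \<le> a * 0"
      using bound by (intro LIMSEQ_le_const) auto
    then show ?thesis by (simp add: F_def a_def mult.commute)
  qed
qed

text \<open>
  Hence such a set is independent of all Borel subsets of the base, in particular of itself.
\<close>

lemma measure_invariant_zero_one: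
  assumes A [measurable]: "A \<in> sets borel"
    and inv: "\<And>y. y \<in> skyscraper \<Longrightarrow> tower_map y \<in> A \<longleftrightarrow> y \<in> A"
  shows "measure lborel (A \<inter> odometer_space) = 0 \<or> measure lborel (A \<inter> odometer_space) = 1"
proof -
  let ?B = "A \<inter> odometer_space"
  define a where "a = measure lborel ?B"
  have fin: "C \<in> fmeasurable lborel" if "C \<subseteq> odometer_space" "C \<in> sets borel" for C
  proof (rule fmeasurableI2)
    show "odometer_space \<in> fmeasurable lborel"
      by (simp add: fmeasurable_def emeasure_odometer_space)
  qed (use that in auto)
  \<comment> \<open>\<open>M\<close> is Lebesgue measure on the trace of \<open>A\<close>, and
    \<open>N\<close> is \<open>a\<close> times Lebesgue measure on the base.\<close>
  define M where "M = density lborel (indicator ?B)"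
  define N where "N = density lborel (\<lambda>x. ennreal a * indicator odometer_space x)"
  have M: "emeasure M C = ennreal (measure lborel (?B \<inter> C))" if [measurable]: "C \<in> sets borel" for C
  proof -
    have "emeasure M C = emeasure lborel (?B \<inter> C)"
      unfolding M_def by (subst emeasure_density) (auto simp: indicator_inter_arith[symmetric])
    also have "\<dots> = ennreal (measure lborel (?B \<inter> C))"
      by (rule emeasure_eq_measure2, rule fin) auto
    finally show ?thesis .
  qed
  have N: "emeasure N C = ennreal (a * measure lborel (odometer_space \<inter> C))"
    if [measurable]: "C \<in> sets borel" for C
  proof -
    have "emeasure N C = (\<integral>\<^sup>+x. ennreal a * indicator (odometer_space \<inter> C) x \<partial>lborel)"
      unfolding N_def by (subst emeasure_density) (auto simp: indicator_inter_arith mult.assoc)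
    also have "\<dots> = ennreal a * emeasure lborel (odometer_space \<inter> C)"
      by (subst nn_integral_cmult_indicator) auto
    also have "\<dots> = ennreal (a * measure lborel (odometer_space \<inter> C))"
      using emeasure_eq_measure2[OF fin, of "odometer_space \<inter> C"] by (simp add: ennreal_mult a_def)
    finally show ?thesis .
  qed
  have "M = N"
  proof (rule measure_eqI_lessThan)
    fix x :: real
    show "emeasure M {x<..} < \<infinity>" by (simp add: M)
    \<comment> \<open>Stated for an arbitrary invariant set, since it is used for \<open>A\<close>
      and, to get the length of a ray inside the base, for \<open>UNIV\<close>. The cut is clamped
      to the unit interval, which contains the base.\<close>
    have eq: "measure lborel (C \<inter> odometer_space \<inter> {x<..})
        = (1 - min 1 (max 0 x)) * measure lborel (C \<inter> odometer_space)"
      if [measurable]: "C \<in> sets borel" and C: "\<And>y. y \<in> skyscraper \<Longrightarrow> tower_map y \<in> C \<longleftrightarrow> y \<in> C" for C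
    proof -
      let ?x = "min 1 (max 0 x)"
      have "measure lborel (C \<inter> odometer_space)
          = measure lborel ((C \<inter> odometer_space \<inter> {..?x}) \<union> (C \<inter> odometer_space \<inter> {x<..}))"
        by (rule arg_cong[where f = "measure lborel"]) (auto simp: odometer_space_def min_def max_def)
      also have "\<dots> = measure lborel (C \<inter> odometer_space \<inter> {..?x}) + measure lborel (C \<inter> odometer_space \<inter> {x<..})"
        by (rule measure_Un_AE) (auto intro!: fin simp: odometer_space_def min_def max_def split: if_splits)
      also have "measure lborel (C \<inter> odometer_space \<inter> {..?x}) = ?x * measure lborel (C \<inter> odometer_space)"
        using C by (intro measure_invariant_atLeast) auto
      finally show ?thesis by (simp add: algebra_simps)
    qed
    have "measure lborel odometer_space = 1" by (simp add: measure_def emeasure_odometer_space)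
    with eq[OF A inv] eq[of UNIV] show "emeasure M {x<..} = emeasure N {x<..}"
      by (simp add: M N a_def mult.commute)
  qed (auto simp: M_def N_def)
  then have "emeasure M ?B = emeasure N ?B" by simp
  moreover have "odometer_space \<inter> ?B = ?B" by auto
  ultimately have "a = a * a" by (simp add: M N a_def)
  then show ?thesis by (simp add: a_def)
qed

text \<open>Every point comes from the base in finitely many steps, so \<open>A\<close> is covered
  by the preimages of its null trace on the base under the iterates of the inverse.\<close>

lemma invariant_null_if_null_in_base:
  assumes A [measurable]: "A \<in> sets borel" "A \<subseteq> skyscraper"
    and inv: "\<And>y. y \<in> skyscraper \<Longrightarrow> tower_map y \<in> A \<longleftrightarrow> y \<in> A"
    and null: "emeasure lborel (A \<inter> odometer_space) = 0"
  shows "emeasure lborel A = 0"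
proof -
  have inv': "tower_map_inv y \<in> A \<longleftrightarrow> y \<in> A" if "y \<in> skyscraper" for y
    using inv[OF tower_map_inv(1)[OF that]] tower_map_inv(2)[OF that] by simp
  let ?C = "\<lambda>n. (tower_map_inv ^^ n) -` (A \<inter> odometer_space) \<inter> skyscraper"
  have meas [measurable]: "?C n \<in> sets borel" for n by measurable
  have C0: "emeasure lborel (?C n) = 0" for n
  proof (induction n)
    case 0
    have "?C 0 = A \<inter> odometer_space" using odometer_space_subset by auto
    with null show ?case by simp
  next
    case (Suc n)
    have "?C (Suc n) = tower_map_inv -` ?C n \<inter> skyscraper"
      using tower_map_inv(1) by (subst funpow_Suc_right) auto
    then show ?case using Suc emeasure_vimage_tower_map_inv[OF _ meas, of n] by (simp only:) auto
  qed
  have "A \<subseteq> (\<Union>n. ?C n)"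
  proof
    fix y assume y: "y \<in> A"
    then have "y \<in> skyscraper" using A by auto
    then obtain t where t: "(tower_map_inv ^^ t) y \<in> odometer_space" using tower_map_inv_returns by auto
    have "(tower_map_inv ^^ t) y \<in> A" for t
      using \<open>y \<in> skyscraper\<close> y by (induction t) (auto simp: inv' funpow_tower_map_inv_mem)
    with t \<open>y \<in> skyscraper\<close> show "y \<in> (\<Union>n. ?C n)" by auto
  qed
  then have "emeasure lborel A \<le> emeasure lborel (\<Union>n. ?C n)" by (intro emeasure_mono) auto
  also have "\<dots> = 0" by (rule emeasure_UN_eq_0[OF C0]) auto
  finally show ?thesis by simp
qed

lemma ergodic_tower_map: "ergodic_transformation tower_measure tower_map"
  unfolding ergodic_transformation_def
proof (intro conjI ballI impI tower_map_measurable)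
  fix A assume "A \<in> sets tower_measure" and eq: "tower_map -` A \<inter> space tower_measure = A"
  then have A [measurable]: "A \<in> sets borel" and sub: "A \<subseteq> skyscraper"
    by (auto simp: sets_tower_measure)
  have inv: "tower_map y \<in> A \<longleftrightarrow> y \<in> A" if "y \<in> skyscraper" for y
    using eq that by auto
  have fin: "odometer_space \<in> fmeasurable lborel"
    by (simp add: fmeasurable_def emeasure_odometer_space)
  then have finA: "A \<inter> odometer_space \<in> fmeasurable lborel" by (rule fmeasurableI2) auto
  from measure_invariant_zero_one[OF A inv]
  show "emeasure tower_measure A = 0 \<or> emeasure tower_measure (space tower_measure - A) = 0"
  proof
    assume "measure lborel (A \<inter> odometer_space) = 0"
    then have "emeasure lborel (A \<inter> odometer_space) = 0"
      using finA by (simp add: emeasure_eq_measure2)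
    from invariant_null_if_null_in_base[OF A sub inv this] show ?thesis
      by (simp add: emeasure_tower_measure sub)
  next
    assume 1: "measure lborel (A \<inter> odometer_space) = 1"
    have "measure lborel (odometer_space - A \<inter> odometer_space) = 0"
      using measurable_measure_Diff[OF fin, of "A \<inter> odometer_space"] 1
      by (simp add: measure_def[of _ odometer_space] emeasure_odometer_space)
    moreover have "(skyscraper - A) \<inter> odometer_space = odometer_space - A \<inter> odometer_space"
      using odometer_space_subset by auto
    moreover have "odometer_space - A \<inter> odometer_space \<in> fmeasurable lborel"
      using fin by (rule fmeasurableI2) auto
    ultimately have "emeasure lborel ((skyscraper - A) \<inter> odometer_space) = 0"
      by (simp add: emeasure_eq_measure2)
    \<comment> \<open>The complement is invariant as well, so a trace of full measure reduces to the
      null case.\<close>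
    moreover have "tower_map y \<in> skyscraper - A \<longleftrightarrow> y \<in> skyscraper - A" if "y \<in> skyscraper" for y
      using inv[OF that] tower_map(1)[OF that] that by blast
    ultimately have "emeasure lborel (skyscraper - A) = 0"
      using A by (intro invariant_null_if_null_in_base[of "skyscraper - A"]) simp_all
    then show ?thesis by (simp add: emeasure_tower_measure)
  qed
qed

section \<open>Comparison of the exponents\<close>

text \<open>On the two values 1 and -1 every function is affine, so the logarithm becomes its mean
  plus a multiple of \<open>u\<close>.\<close>

lemma sum_ln_two_valued:
  fixes u :: "nat \<Rightarrow> real"
  assumes "\<And>i. u i = 1 \<or> u i = - 1"
  shows "(\<Sum>i<n. ln (e + 2 * u i)) =
    (ln (e + 2) + ln (e - 2)) / 2 * real n + (ln (e + 2) - ln (e - 2)) / 2 * (\<Sum>i<n. u i)"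
proof (induction n)
  case (Suc n)
  have "ln (e + 2 * u n) = (ln (e + 2) + ln (e - 2)) / 2 + (ln (e + 2) - ln (e - 2)) / 2 * u n"
    using assms[of n] by (auto simp: field_simps)
  with Suc show ?case by (simp add: field_simps)
qed simp

lemma limsup_le_two_valued:
  fixes u x :: "nat \<Rightarrow> real"
  assumes u: "\<And>i. u i = 1 \<or> u i = - 1" and e: "e > 2"
    and x: "\<And>n. 0 < x n" "\<And>n. x n \<le> (\<Prod>i<n. e + 2 * u i)"
    and C: "\<And>n. (\<Sum>i<n. u i) \<le> C"
  shows "limsup (\<lambda>n. ereal (ln (x n) / real n)) \<le> ereal ((ln (e + 2) + ln (e - 2)) / 2)"
proof -
  let ?a = "(ln (e + 2) + ln (e - 2)) / 2" and ?b = "(ln (e + 2) - ln (e - 2)) / 2"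
  have b: "?b \<ge> 0" using e by simp
  have pos: "e + 2 * u i > 0" for i using u[of i] e by auto
  then have nz: "e + 2 * u i \<noteq> 0" for i by (rule less_imp_neq[THEN not_sym])
  have le: "ln (x n) / real n \<le> ?a + ?b * C / real n" if "n > 0" for n
  proof -
    have "ln (x n) \<le> ln (\<Prod>i<n. e + 2 * u i)"
      using x[of n] by (intro ln_mono)
    also have "\<dots> = (\<Sum>i<n. ln (e + 2 * u i))" by (intro ln_prod) (simp_all add: nz)
    also have "\<dots> \<le> ?a * real n + ?b * C"
      unfolding sum_ln_two_valued[OF u] using b C by (intro add_left_mono mult_left_mono) auto
    finally have "ln (x n) / real n \<le> (?a * real n + ?b * C) / real n"
      by (intro divide_right_mono) auto
    with that show ?thesis by (simp add: add_divide_distrib)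
  qed
  have "limsup (\<lambda>n. ereal (ln (x n) / real n)) \<le> limsup (\<lambda>n. ereal (?a + ?b * C / real n))"
    using le by (intro Limsup_mono eventually_mono[OF eventually_gt_at_top[of 0]]) auto
  also have "(\<lambda>n. ?a + ?b * C / real n) \<longlonglongrightarrow> ?a + 0"
    by (intro tendsto_intros lim_const_over_n)
  then have "limsup (\<lambda>n. ereal (?a + ?b * C / real n)) = ereal ?a"
    by (intro lim_imp_Limsup) auto
  finally show ?thesis .
qed

text \<open>Along times at which almost all \<open>u i\<close> have been 1, the averages of the
  logarithms come close to the larger value \<open>ln (e + 2)\<close>.\<close>

lemma limsup_ge_two_valued:
  fixes u x :: "nat \<Rightarrow> real"
  assumes u: "\<And>i. u i = 1 \<or> u i = - 1" and e: "e > 2"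
    and x: "\<And>n. (\<Prod>i<n. e + 2 * u i) \<le> x n"
    and peaks: "\<And>\<delta> N. \<delta> > 0 \<Longrightarrow> \<exists>n\<ge>N. (\<Sum>i<n. u i) \<ge> (1 - \<delta>) * real n"
  shows "ereal (ln (e + 2)) \<le> limsup (\<lambda>n. ereal (ln (x n) / real n))"
proof (rule ccontr)
  let ?a = "ln (e + 2)" and ?b = "ln (e - 2)"
  assume "\<not> ?thesis"
  then obtain r where r: "limsup (\<lambda>n. ereal (ln (x n) / real n)) < ereal r" "ereal r < ereal ?a"
    using ereal_dense2[of "limsup (\<lambda>n. ereal (ln (x n) / real n))" "ereal ?a"] by (auto simp: not_le)
  have ab: "?b < ?a" using e by simp
  have pos: "e + 2 * u i > 0" for i using u[of i] e by auto
  then have nz: "e + 2 * u i \<noteq> 0" for i by (rule less_imp_neq[THEN not_sym])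
  from Limsup_lessD[OF r(1)] obtain N where N: "\<And>n. n \<ge> N \<Longrightarrow> ln (x n) / real n < r"
    by (auto simp: eventually_sequentially)
  \<comment> \<open>With this choice the loss \<open>\<delta> * (?a - ?b) / 2\<close> is half the
    distance from \<open>r\<close> to \<open>?a\<close>, which leaves the average above
    \<open>r\<close>.\<close>
  define \<delta> where "\<delta> = (?a - r) / (?a - ?b)"
  have "\<delta> > 0" using r ab by (simp add: \<delta>_def)
  \<comment> \<open>\<open>Suc N\<close> rather than \<open>N\<close> makes \<open>n\<close>
    positive for the division below.\<close>
  from peaks[OF this, of "Suc N"] obtain n where n: "n \<ge> Suc N" "(\<Sum>i<n. u i) \<ge> (1 - \<delta>) * real n"
    by auto
  have "?a - (?a - r) / 2 = (?a + ?b) / 2 + (?a - ?b) / 2 * (1 - \<delta>)"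
    using ab by (simp add: \<delta>_def field_simps)
  then have "(?a - (?a - r) / 2) * real n = (?a + ?b) / 2 * real n + (?a - ?b) / 2 * ((1 - \<delta>) * real n)"
    by (simp only: distrib_right mult.assoc)
  also have "\<dots> \<le> (?a + ?b) / 2 * real n + (?a - ?b) / 2 * (\<Sum>i<n. u i)"
    using n ab by (intro add_left_mono mult_left_mono) auto
  also have "\<dots> = ln (\<Prod>i<n. e + 2 * u i)"
    unfolding sum_ln_two_valued[OF u, symmetric] by (intro ln_prod[symmetric]) (simp_all add: nz)
  also have "\<dots> \<le> ln (x n)"
    using x[of n] pos by (intro ln_mono prod_pos) auto
  finally have "?a - (?a - r) / 2 \<le> ln (x n) / real n"
    using n by (simp add: pos_le_divide_eq)
  moreover have "ln (x n) / real n < r" using N[of n] n by simp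
  moreover have "r < ?a" using r by simp
  ultimately show False by argo
qed

section \<open>The potential and bounds for its exponents\<close>

definition potential :: "real \<Rightarrow> real" where "potential y = - 2 * step y"

lemma step_cases: "step y = 1 \<or> step y = - 1"
  by (simp add: step_def)

text \<open>Reversing the sign of \<open>E\<close> interchanges the lower and the upper halves of
  the towers; the factor \<open>sgn E\<close> lets one argument cover both cases.\<close>

lemma abs_diff_potential:
  assumes "\<bar>E\<bar> > 4"
  shows "\<bar>E - potential y\<bar> = \<bar>E\<bar> + 2 * (sgn E * step y)"
  using assms step_cases[of y] by (cases "E > 0") (auto simp: potential_def)

text \<open>In \<open>mid m = Suc m * Suc (height m)\<close> the second factor absorbs the waiting
  time before the tower, and the first absorbs \<open>t0\<close>, \<open>c\<close> and
  \<open>1 / \<delta>\<close>. So nearly all of the elapsed time is spent climbing.\<close>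

lemma peaks:
  fixes w :: "nat \<Rightarrow> real"
  assumes w: "\<And>N. \<exists>t k. t \<le> t0 + height N \<and> N \<le> k \<and> w (t + mid k) = real (mid k) - c"
    and "\<delta> > 0"
  shows "\<exists>n\<ge>N. w n \<ge> (1 - \<delta>) * real n"
proof -
  obtain n0 :: nat where n0: "(real t0 + \<bar>c\<bar> + 1) / \<delta> < real n0" using reals_Archimedean2 by blast
  define m where "m = max n0 N"
  obtain t k where t: "t \<le> t0 + height m" "m \<le> k" and wt: "w (t + mid k) = real (mid k) - c"
    using w by blast
  have "real t + c \<le> real t0 + real (height m) + \<bar>c\<bar>" using t by linarith
  also have "\<dots> \<le> (real t0 + \<bar>c\<bar> + 1) * real (Suc (height m))"
    by (simp add: algebra_simps)
  also have "\<dots> \<le> (\<delta> * real (Suc m)) * real (Suc (height m))"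
  proof (rule mult_right_mono)
    have "real t0 + \<bar>c\<bar> + 1 \<le> \<delta> * real n0" using n0 \<open>\<delta> > 0\<close> by (simp add: field_simps)
    also have "\<dots> \<le> \<delta> * real (Suc m)" using \<open>\<delta> > 0\<close> by (intro mult_left_mono) (auto simp: m_def)
    finally show "real t0 + \<bar>c\<bar> + 1 \<le> \<delta> * real (Suc m)" .
  qed simp
  also have "\<dots> = \<delta> * real (mid m)" by (simp only: mid_def of_nat_mult mult.assoc)
  also have "\<dots> \<le> \<delta> * real (mid k)" using mid_mono[OF t(2)] \<open>\<delta> > 0\<close> by (intro mult_left_mono) auto
  also have "\<dots> \<le> \<delta> * real (t + mid k)" using \<open>\<delta> > 0\<close> by (intro mult_left_mono) auto
  finally have "(1 - \<delta>) * real (t + mid k) \<le> w (t + mid k)"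
    unfolding wt by (simp add: algebra_simps)
  moreover have "m * 1 \<le> Suc m * Suc (height m)" by (intro mult_mono) auto
  then have "N \<le> mid k" using mid_mono[OF t(2)] by (simp add: mid_def m_def)
  then have "N \<le> t + mid k" by simp
  ultimately show ?thesis by blast
qed

lemma inverse_map_funpow:
  assumes "y \<in> skyscraper"
  shows "(inverse_map tower_measure tower_map ^^ n) y = (tower_map_inv ^^ n) y"
  by (induction n) (simp_all add: inverse_map_tower_map funpow_tower_map_inv_mem[OF assms])

abbreviation forward_norm :: "real \<Rightarrow> real \<Rightarrow> nat \<Rightarrow> real" where
  "forward_norm E y n \<equiv> mnorm (mprod tower_map (transfer_matrix potential E) n y)"

abbreviation backward_norm :: "real \<Rightarrow> real \<Rightarrow> nat \<Rightarrow> real" where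
  "backward_norm E y n \<equiv> mnorm (mprod (inverse_map tower_measure tower_map)
    (\<lambda>y. matrix_inv (transfer_matrix potential E (inverse_map tower_measure tower_map y))) n y)"

lemma forward_norm_bounds:
  fixes y :: real
  assumes "\<bar>E\<bar> > 4"
  defines "u \<equiv> \<lambda>i. sgn E * step ((tower_map ^^ i) y)"
  shows "(\<Prod>i<n. (\<bar>E\<bar> - 1) + 2 * u i) \<le> forward_norm E y n"
    and "forward_norm E y n \<le> (\<Prod>i<n. (\<bar>E\<bar> + 1) + 2 * u i)"
proof -
  have d: "\<bar>E - potential ((tower_map ^^ i) y)\<bar> = \<bar>E\<bar> + 2 * u i" for i
    using assms(1) by (simp only: abs_diff_potential u_def)
  have u: "u i \<ge> - 1" for i
    using step_cases[of "(tower_map ^^ i) y"] by (auto simp: u_def sgn_if)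
  have "\<bar>E - potential ((tower_map ^^ i) y)\<bar> \<ge> 2" for i using d[of i] u[of i] assms(1) by simp
  from mnorm_forward_ge[of E potential tower_map y, OF this, of n]
  show "(\<Prod>i<n. (\<bar>E\<bar> - 1) + 2 * u i) \<le> forward_norm E y n"
    unfolding d by (simp add: algebra_simps)
  have "forward_norm E y n \<le> (\<Prod>i<n. \<bar>E - potential ((tower_map ^^ i) y)\<bar> + 1)"
    by (intro mnorm_mprod_le norm_transfer_matrix_le) simp
  then show "forward_norm E y n \<le> (\<Prod>i<n. (\<bar>E\<bar> + 1) + 2 * u i)"
    unfolding d by (simp add: algebra_simps)
qed

lemma backward_norm_bounds:
  assumes "\<bar>E\<bar> > 4" and y: "y \<in> skyscraper"
  defines "u \<equiv> \<lambda>i. sgn E * step ((tower_map_inv ^^ Suc i) y)"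
  shows "(\<Prod>i<n. (\<bar>E\<bar> - 1) + 2 * u i) \<le> backward_norm E y n"
    and "backward_norm E y n \<le> (\<Prod>i<n. (\<bar>E\<bar> + 1) + 2 * u i)"
proof -
  let ?S = "inverse_map tower_measure tower_map"
  have d: "\<bar>E - potential ((?S ^^ Suc i) y)\<bar> = \<bar>E\<bar> + 2 * u i" for i
    using assms(1) by (simp only: abs_diff_potential u_def inverse_map_funpow[OF y])
  have u: "u i \<ge> - 1" for i
    using step_cases[of "(tower_map_inv ^^ Suc i) y"] by (auto simp: u_def sgn_if)
  have "\<bar>E - potential ((?S ^^ Suc i) y)\<bar> \<ge> 2" for i using d[of i] u[of i] assms(1) by simp
  from mnorm_backward_ge[of E potential ?S y, OF this, of n]
  show "(\<Prod>i<n. (\<bar>E\<bar> - 1) + 2 * u i) \<le> backward_norm E y n"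
    unfolding d by (simp add: algebra_simps)
  have "backward_norm E y n \<le> (\<Prod>i<n. \<bar>E - potential ((?S ^^ Suc i) y)\<bar> + 1)"
    unfolding funpow.simps(2) comp_apply
    by (intro mnorm_mprod_le norm_matrix_inv_transfer_matrix_le) simp
  then show "backward_norm E y n \<le> (\<Prod>i<n. (\<bar>E\<bar> + 1) + 2 * u i)"
    unfolding d by (simp add: algebra_simps)
qed

text \<open>The lower bounds on the norms are centred at \<open>e - 1\<close> and the upper ones at
  \<open>e + 1\<close>. So peaks give \<open>ln ((e - 1) + 2)\<close>, and sums bounded above give
  the mean of \<open>ln ((e + 1) + 2)\<close> and \<open>ln ((e + 1) - 2)\<close>.\<close>

lemma two_valued_growth:
  fixes u x :: "nat \<Rightarrow> real"
  assumes u: "\<And>i. u i = 1 \<or> u i = - 1" and e: "e > 4"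
    and lower: "\<And>n. (\<Prod>i<n. (e - 1) + 2 * u i) \<le> x n"
    and upper: "\<And>n. x n \<le> (\<Prod>i<n. (e + 1) + 2 * u i)"
  shows "(\<And>\<delta> N. \<delta> > 0 \<Longrightarrow> \<exists>n\<ge>N. (\<Sum>i<n. u i) \<ge> (1 - \<delta>) * real n) \<Longrightarrow>
      ereal (ln (e + 1)) \<le> limsup (\<lambda>n. ereal (ln (x n) / real n))"
    and "(\<And>n. (\<Sum>i<n. u i) \<le> C) \<Longrightarrow>
      limsup (\<lambda>n. ereal (ln (x n) / real n)) \<le> ereal ((ln (e + 3) + ln (e - 1)) / 2)"
proof -
  assume "\<And>\<delta> N. \<delta> > 0 \<Longrightarrow> \<exists>n\<ge>N. (\<Sum>i<n. u i) \<ge> (1 - \<delta>) * real n"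
  with limsup_ge_two_valued[OF u _ lower] e
  have "ereal (ln (e - 1 + 2)) \<le> limsup (\<lambda>n. ereal (ln (x n) / real n))" by simp
  then show "ereal (ln (e + 1)) \<le> limsup (\<lambda>n. ereal (ln (x n) / real n))" by (simp add: add.commute)
next
  assume C: "\<And>n. (\<Sum>i<n. u i) \<le> C"
  have "0 < (\<Prod>i<n. (e - 1) + 2 * u i)" for n
  proof (rule prod_pos)
    show "0 < (e - 1) + 2 * u i" for i using u[of i] e by auto
  qed
  then have "0 < x n" for n using lower[of n] by (rule order_less_le_trans)
  from limsup_le_two_valued[OF u _ this upper C] e
  have "limsup (\<lambda>n. ereal (ln (x n) / real n)) \<le> ereal ((ln (e + 1 + 2) + ln (e + 1 - 2)) / 2)"
    by simp
  then show "limsup (\<lambda>n. ereal (ln (x n) / real n)) \<le> ereal ((ln (e + 3) + ln (e - 1)) / 2)"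
    by (simp add: algebra_simps)
qed

text \<open>For positive \<open>E\<close> the sums of \<open>u\<close> are those of
  \<open>step\<close> and have peaks. For negative \<open>E\<close> they change sign and are at most
  \<open>walk y\<close>, because \<open>walk\<close> is nonnegative.\<close>

lemma limsup_forward:
  assumes y: "y \<in> skyscraper"
  shows "E > 4 \<Longrightarrow> ereal (ln (\<bar>E\<bar> + 1)) \<le> limsup (\<lambda>n. ereal (ln (forward_norm E y n) / real n))"
    and "E < - 4 \<Longrightarrow> limsup (\<lambda>n. ereal (ln (forward_norm E y n) / real n))
        \<le> ereal ((ln (\<bar>E\<bar> + 3) + ln (\<bar>E\<bar> - 1)) / 2)"
proof -
  define u where "u = (\<lambda>i. sgn E * step ((tower_map ^^ i) y))"
  have sum: "(\<Sum>i<n. u i) = sgn E * (walk ((tower_map ^^ n) y) - walk y)" for n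
    unfolding u_def sum_distrib_left[symmetric] sum_step_forward[OF y] ..
  have growth: "(\<And>\<delta> N. \<delta> > 0 \<Longrightarrow> \<exists>n\<ge>N. (\<Sum>i<n. u i) \<ge> (1 - \<delta>) * real n) \<Longrightarrow>
      ereal (ln (\<bar>E\<bar> + 1)) \<le> limsup (\<lambda>n. ereal (ln (forward_norm E y n) / real n))"
    "(\<And>n. (\<Sum>i<n. u i) \<le> walk y) \<Longrightarrow> limsup (\<lambda>n. ereal (ln (forward_norm E y n) / real n))
      \<le> ereal ((ln (\<bar>E\<bar> + 3) + ln (\<bar>E\<bar> - 1)) / 2)" if E: "\<bar>E\<bar> > 4"
  proof -
    have u: "u i = 1 \<or> u i = - 1" for i
      using step_cases[of "(tower_map ^^ i) y"] that by (auto simp: u_def sgn_if)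
    show "(\<And>\<delta> N. \<delta> > 0 \<Longrightarrow> \<exists>n\<ge>N. (\<Sum>i<n. u i) \<ge> (1 - \<delta>) * real n) \<Longrightarrow>
        ereal (ln (\<bar>E\<bar> + 1)) \<le> limsup (\<lambda>n. ereal (ln (forward_norm E y n) / real n))"
      by (rule two_valued_growth(1)[of u, OF u E]) (use forward_norm_bounds[OF E, where y = y] in \<open>auto simp: u_def\<close>)
    show "(\<And>n. (\<Sum>i<n. u i) \<le> walk y) \<Longrightarrow> limsup (\<lambda>n. ereal (ln (forward_norm E y n) / real n))
        \<le> ereal ((ln (\<bar>E\<bar> + 3) + ln (\<bar>E\<bar> - 1)) / 2)"
      by (rule two_valued_growth(2)[of u, OF u E]) (use forward_norm_bounds[OF E, where y = y] in \<open>auto simp: u_def\<close>)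
  qed
  show "ereal (ln (\<bar>E\<bar> + 1)) \<le> limsup (\<lambda>n. ereal (ln (forward_norm E y n) / real n))" if "E > 4"
  proof (rule growth(1))
    obtain t0 where t0: "\<And>N. \<exists>t k. t \<le> t0 + height N \<and> N \<le> k
        \<and> walk ((tower_map ^^ (t + mid k)) y) = real (mid k)"
      using forward_peak[OF y] by blast
    show "\<exists>n\<ge>N. (\<Sum>i<n. u i) \<ge> (1 - \<delta>) * real n" if "\<delta> > 0" for \<delta> N
    proof (rule peaks[where c = "walk y", OF _ that])
      show "\<exists>t k. t \<le> t0 + height N \<and> N \<le> k \<and> (\<Sum>i<t + mid k. u i) = real (mid k) - walk y" for N
        using t0[of N] \<open>E > 4\<close> unfolding sum by auto
    qed
  qed (use that in simp)
  show "limsup (\<lambda>n. ereal (ln (forward_norm E y n) / real n))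
      \<le> ereal ((ln (\<bar>E\<bar> + 3) + ln (\<bar>E\<bar> - 1)) / 2)" if "E < - 4"
  proof (rule growth(2))
    show "(\<Sum>i<n. u i) \<le> walk y" for n
      unfolding sum using that walk_nonneg[OF funpow_tower_map_mem[OF y, of n]] by (simp add: sgn_if)
  qed (use that in simp)
qed

text \<open>The two signs of \<open>E\<close> exchange their roles, as \<open>walk\<close> now
  enters with the opposite sign.\<close>

lemma limsup_backward:
  assumes y: "y \<in> skyscraper"
  shows "E < - 4 \<Longrightarrow> ereal (ln (\<bar>E\<bar> + 1)) \<le> limsup (\<lambda>n. ereal (ln (backward_norm E y n) / real n))"
    and "E > 4 \<Longrightarrow> limsup (\<lambda>n. ereal (ln (backward_norm E y n) / real n))
        \<le> ereal ((ln (\<bar>E\<bar> + 3) + ln (\<bar>E\<bar> - 1)) / 2)"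
proof -
  define u where "u = (\<lambda>i. sgn E * step ((tower_map_inv ^^ Suc i) y))"
  have sum: "(\<Sum>i<n. u i) = sgn E * (walk y - walk ((tower_map_inv ^^ n) y))" for n
    unfolding u_def sum_distrib_left[symmetric] sum_step_backward[OF y] ..
  have growth: "(\<And>\<delta> N. \<delta> > 0 \<Longrightarrow> \<exists>n\<ge>N. (\<Sum>i<n. u i) \<ge> (1 - \<delta>) * real n) \<Longrightarrow>
      ereal (ln (\<bar>E\<bar> + 1)) \<le> limsup (\<lambda>n. ereal (ln (backward_norm E y n) / real n))"
    "(\<And>n. (\<Sum>i<n. u i) \<le> walk y) \<Longrightarrow> limsup (\<lambda>n. ereal (ln (backward_norm E y n) / real n))
      \<le> ereal ((ln (\<bar>E\<bar> + 3) + ln (\<bar>E\<bar> - 1)) / 2)" if E: "\<bar>E\<bar> > 4"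
  proof -
    have u: "u i = 1 \<or> u i = - 1" for i
      using step_cases[of "(tower_map_inv ^^ Suc i) y"] that by (auto simp: u_def sgn_if)
    show "(\<And>\<delta> N. \<delta> > 0 \<Longrightarrow> \<exists>n\<ge>N. (\<Sum>i<n. u i) \<ge> (1 - \<delta>) * real n) \<Longrightarrow>
        ereal (ln (\<bar>E\<bar> + 1)) \<le> limsup (\<lambda>n. ereal (ln (backward_norm E y n) / real n))"
      by (rule two_valued_growth(1)[of u, OF u E]) (use backward_norm_bounds[OF E y] in \<open>auto simp: u_def\<close>)
    show "(\<And>n. (\<Sum>i<n. u i) \<le> walk y) \<Longrightarrow> limsup (\<lambda>n. ereal (ln (backward_norm E y n) / real n))
        \<le> ereal ((ln (\<bar>E\<bar> + 3) + ln (\<bar>E\<bar> - 1)) / 2)"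
      by (rule two_valued_growth(2)[of u, OF u E]) (use backward_norm_bounds[OF E y] in \<open>auto simp: u_def\<close>)
  qed
  show "ereal (ln (\<bar>E\<bar> + 1)) \<le> limsup (\<lambda>n. ereal (ln (backward_norm E y n) / real n))" if "E < - 4"
  proof (rule growth(1))
    obtain t0 where t0: "\<And>N. \<exists>t k. t \<le> t0 + height N \<and> N \<le> k
        \<and> walk ((tower_map_inv ^^ (t + mid k)) y) = real (mid k)"
      using backward_peak[OF y] by blast
    show "\<exists>n\<ge>N. (\<Sum>i<n. u i) \<ge> (1 - \<delta>) * real n" if "\<delta> > 0" for \<delta> N
    proof (rule peaks[where c = "walk y", OF _ that])
      show "\<exists>t k. t \<le> t0 + height N \<and> N \<le> k \<and> (\<Sum>i<t + mid k. u i) = real (mid k) - walk y" for N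
        using t0[of N] \<open>E < - 4\<close> unfolding sum by auto
    qed
  qed (use that in simp)
  show "limsup (\<lambda>n. ereal (ln (backward_norm E y n) / real n))
      \<le> ereal ((ln (\<bar>E\<bar> + 3) + ln (\<bar>E\<bar> - 1)) / 2)" if "E > 4"
  proof (rule growth(2))
    show "(\<Sum>i<n. u i) \<le> walk y" for n
      unfolding sum using that walk_nonneg[OF funpow_tower_map_inv_mem[OF y, of n]] by (simp add: sgn_if)
  qed (use that in simp)
qed

lemma ln_gap:
  assumes "(e :: real) > 4" shows "(ln (e + 3) + ln (e - 1)) / 2 < ln (e + 1)"
proof -
  have "ln (e + 3) + ln (e - 1) = ln ((e + 3) * (e - 1))" using assms by (simp add: ln_mult)
  also have "\<dots> < ln ((e + 1) * (e + 1))"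
    using assms by (intro ln_less_cancel_iff[THEN iffD2] mult_pos_pos) (auto simp: algebra_simps)
  also have "\<dots> = 2 * ln (e + 1)" using assms by (simp add: ln_mult)
  finally show ?thesis by simp
qed

section \<open>Existence and realization of the exponents for the skyscraper\<close>

lemma ergodic_inverse_map:
  assumes T: "invertible_transformation \<Omega> T" and erg: "ergodic_transformation \<Omega> T"
  shows "ergodic_transformation \<Omega> (inverse_map \<Omega> T)"
  unfolding ergodic_transformation_def
proof (intro conjI ballI impI)
  show "inverse_map \<Omega> T \<in> measurable \<Omega> \<Omega>" using T by (simp add: invertible_transformation_def)
  fix A assume A: "A \<in> sets \<Omega>" and eq: "inverse_map \<Omega> T -` A \<inter> space \<Omega> = A"
  have bij: "bij_betw T (space \<Omega>) (space \<Omega>)" using T by (simp add: invertible_transformation_def)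
  \<comment> \<open>Invariance under the inverse, read at \<open>T \<omega>\<close>, is invariance
    under \<open>T\<close>.\<close>
  have "T \<omega> \<in> A \<longleftrightarrow> \<omega> \<in> A" if "\<omega> \<in> space \<Omega>" for \<omega>
  proof -
    have "T \<omega> \<in> space \<Omega>" using bij that by (auto simp: bij_betw_def)
    moreover have "inverse_map \<Omega> T (T \<omega>) = \<omega>"
      unfolding inverse_map_def using bij that by (simp add: bij_betw_def)
    moreover have "T \<omega> \<in> A \<longleftrightarrow> T \<omega> \<in> inverse_map \<Omega> T -` A \<inter> space \<Omega>" by (simp only: eq)
    ultimately show ?thesis by simp
  qed
  then have "T -` A \<inter> space \<Omega> = A" using sets.sets_into_space[OF A] by auto
  then show "emeasure \<Omega> A = 0 \<or> emeasure \<Omega> (space \<Omega> - A) = 0"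
    using erg A by (simp add: ergodic_transformation_def)
qed

lemma emeasure_space_tower_measure: "emeasure tower_measure (space tower_measure) = \<infinity>"
  by (simp add: emeasure_tower_measure emeasure_skyscraper del: space_tower_measure)
    (simp add: emeasure_tower_measure emeasure_skyscraper)

lemma measurable_potential: "potential \<in> borel_measurable borel"
  unfolding potential_def[abs_def] step_def by measurable

lemma simple_function_transfer_matrix:
  "simple_function tower_measure (transfer_matrix potential E)"
proof -
  have "potential y \<in> {-2, 2}" for y using step_cases[of y] by (auto simp: potential_def)
  then have "potential ` space tower_measure \<subseteq> {-2, 2}" by blast
  then have "simple_function tower_measure potential"
    by (intro simple_function_borel_measurable measurable_tower_measure measurable_potential)
      (auto intro: finite_subset)
  from simple_function_compose1[OF this, of "\<lambda>s. vector [vector [E - s, - 1], vector [1, 0]] :: real ^ 2 ^ 2"]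
  show ?thesis by (simp add: transfer_matrix_def[abs_def])
qed

lemma potential_bounds: "\<bar>E - potential y\<bar> + 1 \<le> \<bar>E\<bar> + 3"
  using step_cases[of y] by (auto simp: potential_def)

text \<open>\<open>\<bar>E\<bar> + 3\<close> serves as the constant \<open>K\<close> in both
  directions of time.\<close>

lemma transfer_matrix_norm_bounds:
  "norm (transfer_matrix potential E y *v v) \<le> (\<bar>E\<bar> + 3) * norm v"
  "norm (matrix_inv (transfer_matrix potential E y) *v v) \<le> (\<bar>E\<bar> + 3) * norm v"
proof -
  have "(\<bar>E - potential y\<bar> + 1) * norm v \<le> (\<bar>E\<bar> + 3) * norm v"
    by (intro mult_right_mono potential_bounds norm_ge_zero)
  then show "norm (transfer_matrix potential E y *v v) \<le> (\<bar>E\<bar> + 3) * norm v"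
    "norm (matrix_inv (transfer_matrix potential E y) *v v) \<le> (\<bar>E\<bar> + 3) * norm v"
    using norm_transfer_matrix_le[of potential E y v]
      norm_matrix_inv_transfer_matrix_le[of potential E y v] by simp_all
qed

lemma transfer_matrix_mult_inverse:
  "transfer_matrix f E \<omega> ** matrix_inv (transfer_matrix f E \<omega>) = mat 1"
  "matrix_inv (transfer_matrix f E \<omega>) ** transfer_matrix f E \<omega> = mat 1"
  by (simp_all add: matrix_eq transfer_matrix_cancel matrix_vector_mul_assoc[symmetric])

lemma lyapunov_plus_exists: "\<exists>L. has_upper_lyapunov_plus tower_measure tower_map potential E L"
  unfolding has_upper_lyapunov_plus_def Limsup_growth_rate_at_top
proof (rule upper_lyapunov_exponent_exists[OF ergodic_tower_map simple_function_transfer_matrix])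
  fix y v
  show "norm (transfer_matrix potential E y *v v) \<le> (\<bar>E\<bar> + 3) * norm v"
    by (rule transfer_matrix_norm_bounds)
  show "norm v \<le> (\<bar>E\<bar> + 3) * norm (transfer_matrix potential E y *v v)"
    using transfer_matrix_norm_bounds(2)[of E y "transfer_matrix potential E y *v v"]
    by (simp add: transfer_matrix_cancel)
  show "\<exists>C. transfer_matrix potential E y ** C = mat 1 \<and> mnorm C \<le> \<bar>E\<bar> + 3"
    by (rule exI, rule conjI, rule transfer_matrix_mult_inverse(1),
        rule mnorm_le, rule transfer_matrix_norm_bounds(2))
qed (simp_all add: emeasure_space_tower_measure del: space_tower_measure)

lemma lyapunov_minus_exists: "\<exists>L. has_upper_lyapunov_minus tower_measure tower_map potential E L"
  unfolding has_upper_lyapunov_minus_def Limsup_growth_rate_at_bot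
proof (rule upper_lyapunov_exponent_exists[OF ergodic_inverse_map[OF invertible_tower_map ergodic_tower_map]])
  let ?S = "inverse_map tower_measure tower_map"
  have "?S \<in> measurable tower_measure tower_measure"
    using invertible_tower_map by (simp add: invertible_transformation_def)
  from simple_function_comp[OF this simple_function_compose1[OF simple_function_transfer_matrix, of matrix_inv]]
  show "simple_function tower_measure (\<lambda>y. matrix_inv (transfer_matrix potential E (?S y)))" .
  fix y v
  show "norm (matrix_inv (transfer_matrix potential E (?S y)) *v v) \<le> (\<bar>E\<bar> + 3) * norm v"
    by (rule transfer_matrix_norm_bounds)
  show "norm v \<le> (\<bar>E\<bar> + 3) * norm (matrix_inv (transfer_matrix potential E (?S y)) *v v)"
    using transfer_matrix_norm_bounds(1)[of E "?S y" "matrix_inv (transfer_matrix potential E (?S y)) *v v"]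
    by (simp add: transfer_matrix_cancel)
  show "\<exists>C. matrix_inv (transfer_matrix potential E (?S y)) ** C = mat 1 \<and> mnorm C \<le> \<bar>E\<bar> + 3"
    by (rule exI, rule conjI, rule transfer_matrix_mult_inverse(2),
        rule mnorm_le, rule transfer_matrix_norm_bounds(1))
qed (simp_all add: emeasure_space_tower_measure del: space_tower_measure)

text \<open>The growth bounds hold at every point, so the exponents can be compared at one point
  where both are attained; it exists because the space is not null.\<close>

lemma lyapunov_realized:
  assumes "has_upper_lyapunov_plus tower_measure tower_map potential E L"
    and "has_upper_lyapunov_minus tower_measure tower_map potential E L'"
  obtains y where "y \<in> skyscraper"
    "limsup (\<lambda>n. ereal (ln (forward_norm E y n) / real n)) = ereal L"
    "limsup (\<lambda>n. ereal (ln (backward_norm E y n) / real n)) = ereal L'"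
proof -
  have "AE y in tower_measure. limsup (\<lambda>n. ereal (ln (forward_norm E y n) / real n)) = ereal L \<and>
      limsup (\<lambda>n. ereal (ln (backward_norm E y n) / real n)) = ereal L'"
    using assms
    unfolding has_upper_lyapunov_plus_def Limsup_growth_rate_at_top
      has_upper_lyapunov_minus_def Limsup_growth_rate_at_bot
    by eventually_elim simp
  from AE_ex_in_space[OF this] show thesis
    using that emeasure_space_tower_measure by auto
qed

theorem proposition6p5:
  "\<exists>(\<Omega> :: real measure) (T :: real \<Rightarrow> real) (f :: real \<Rightarrow> real) (M :: real)
     (Lplus :: real \<Rightarrow> real) (Lminus :: real \<Rightarrow> real).
     sigma_finite_measure \<Omega> \<and> emeasure \<Omega> (space \<Omega>) = \<infinity> \<and>
     conservative_transformation \<Omega> T \<and> invertible_transformation \<Omega> T \<and>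
     measure_preserving_transformation \<Omega> T \<and> ergodic_transformation \<Omega> T \<and>
     f \<in> borel_measurable \<Omega> \<and> bounded (f ` space \<Omega>) \<and>
     M > 0 \<and>
     (\<forall>E. has_upper_lyapunov_plus \<Omega> T f E (Lplus E)) \<and>
     (\<forall>E. has_upper_lyapunov_minus \<Omega> T f E (Lminus E)) \<and>
     (\<forall>E. E > M \<longrightarrow> Lplus E > Lminus E) \<and>
     (\<forall>E. E < - M \<longrightarrow> Lplus E < Lminus E)"
proof -
  \<comment> \<open>Existence holds for every real \<open>E\<close>, also below the threshold, so
    both exponents can be chosen as functions of \<open>E\<close>.\<close>
  obtain Lplus where plus: "\<And>E. has_upper_lyapunov_plus tower_measure tower_map potential E (Lplus E)"
    using lyapunov_plus_exists by metis
  obtain Lminus where minus: "\<And>E. has_upper_lyapunov_minus tower_measure tower_map potential E (Lminus E)"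
    using lyapunov_minus_exists by metis
  \<comment> \<open>The threshold 4 keeps \<open>\<bar>E - potential y\<bar>\<close> above 2, so the
    growth bounds apply.\<close>
  have pos: "Lplus E > Lminus E" if "E > 4" for E
  proof -
    obtain y where y: "y \<in> skyscraper"
      "limsup (\<lambda>n. ereal (ln (forward_norm E y n) / real n)) = ereal (Lplus E)"
      "limsup (\<lambda>n. ereal (ln (backward_norm E y n) / real n)) = ereal (Lminus E)"
      by (rule lyapunov_realized[OF plus minus])
    have "ln (\<bar>E\<bar> + 1) \<le> Lplus E" "Lminus E \<le> (ln (\<bar>E\<bar> + 3) + ln (\<bar>E\<bar> - 1)) / 2"
      using limsup_forward(1)[OF y(1) that] limsup_backward(2)[OF y(1) that]
      unfolding y by (simp_all only: ereal_less_eq)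
    with ln_gap[of "\<bar>E\<bar>"] that show ?thesis by linarith
  qed
  have neg: "Lplus E < Lminus E" if "E < - 4" for E
  proof -
    obtain y where y: "y \<in> skyscraper"
      "limsup (\<lambda>n. ereal (ln (forward_norm E y n) / real n)) = ereal (Lplus E)"
      "limsup (\<lambda>n. ereal (ln (backward_norm E y n) / real n)) = ereal (Lminus E)"
      by (rule lyapunov_realized[OF plus minus])
    have "ln (\<bar>E\<bar> + 1) \<le> Lminus E" "Lplus E \<le> (ln (\<bar>E\<bar> + 3) + ln (\<bar>E\<bar> - 1)) / 2"
      using limsup_forward(2)[OF y(1) that] limsup_backward(1)[OF y(1) that]
      unfolding y by (simp_all only: ereal_less_eq)
    with ln_gap[of "\<bar>E\<bar>"] that show ?thesis by linarith
  qed
  have "bounded (potential ` space tower_measure)"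
  proof (rule boundedI[of _ 2])
    fix r assume "r \<in> potential ` space tower_measure"
    then obtain y where "r = potential y" by auto
    then show "norm r \<le> 2" using step_cases[of y] by (auto simp: potential_def)
  qed
  then show ?thesis
    using sigma_finite_tower_measure emeasure_space_tower_measure conservative_tower_map
      invertible_tower_map measure_preserving_tower_map ergodic_tower_map
      measurable_tower_measure[OF measurable_potential] plus minus pos neg
    by (rule_tac exI[of _ tower_measure], rule_tac exI[of _ tower_map], rule_tac exI[of _ potential],
        rule_tac exI[of _ 4], rule_tac exI[of _ Lplus], rule_tac exI[of _ Lminus]) simp
qed

end
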